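(* Let $G=(N,(n_i)_{i\in[N]})$ be a multi-unit game with $N\ge 3$ players, and let $\mathbf s$ be a pure strategy profile of $G$. Then $\mathbf s$ is a (pure) Nash equilibrium of $G$ if and only if all of the following hold: 1. No lone facility has a neighboring facility of the same player under $\mathbf s$; that is, there is no player $i$ and no $f,f'\in s_i$ such that $f$ is a lone facility of player $i$ and $f'$ is a neighbor of $f$. 2. All the facilities owned by the same player attract the same customer mass: $\mathcal V_i(f;\mathbf s)=\mathcal V_i(f';\mathbf s)$ for all $i\in[N]$ and $f,f'\in s_i$. 3. The flattened profile $\tilde{\mathbf s}$ is a pure Nash equilibrium of the flattened game $\tilde G$.
   Context: Multi-unit game $G=(N,(n_i)_{i\in[N]})$: customers are uniformly distributed on $[0,1]$; $[N]=\{1,\dots,N\}$ is the set of players; $n_1\le\dots\le n_N$ are positive integers. The pure strategy set of player $i$ is $S_i=\{(s_i^1,\dots,s_i^{n_i})\in[0,1]^{n_i}: s_i^1<\dots<s_i^{n_i}\}$; a pure strategy is identified with the set of its coordinates (player $i$'s facilities). For a pure profile $\mathbf s=(s_1,\dots,s_N)$ let $\mathcal L(\mathbf s)=\bigcup_i s_i$, $d(t,A)=\min_{f\in A}|t-f|$, and $r_t(\mathbf s)=\{i\in[N]: d(t,s_i)\le d(t,\mathcal L(\mathbf s))\}$. The payoff is $u_i(\mathbf s)=\int_0^1\frac{\mathbf 1[i\in r_t(\mathbf s)]}{|r_t(\mathbf s)|}\,dt$. A pure profile is a pure Nash equilibrium if no player can strictly increase her payoff by a unilateral change of pure strategy. For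 $f\in s_i$, the customer mass attracted to $f$ is $\mathcal V_i(f;\mathbf s)=\int_0^1\frac{\mathbf 1[|t-f|\le d(t,\mathcal L(\mathbf s))]}{|r_t(\mathbf s)|}\,dt$. A facility $f\in s_i$ is lone if no player $j\ne i$ has $f\in s_j$. Two points $f_1,f_2\in\mathcal L(\mathbf s)$ are neighbors if $f_1\neq f_2$ and the open interval between them contains no point of $\mathcal L(\mathbf s)$. The flattened game $\tilde G$ of $G$ is the game $(n,(1)_{i\in[n]})$ with $n=\sum_{i=1}^N n_i$ players, each having a single facility. A flattened profile of $\mathbf s$ is a pure profile $\tilde{\mathbf s}=(\tilde s_1,\dots,\tilde s_n)\in[0,1]^n$ of $\tilde G$ such that, for some bijection $M:\{(i,j):i\in[N],j\in[n_i]\}\to[n]$, $\tilde s_{M(i,j)}=s_i^j$ for all $i,j$. All flattened profiles of $\mathbf s$ coincide up to renaming the players of the symmetric game $\tilde G$, so it does not matter which is used. *)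

theory Defs
  imports "HOL-Analysis.Analysis"
begin

text \<open>
  A game is given by the number \<open>N\<close> of players, who are the elements of \<open>{1..N}\<close>, and the numbers
  \<open>n i\<close> of facilities of the players \<open>i\<close>. A strategy is a strictly increasing list of reals;
  coordinates of lists are counted from 0.
\<close>

definition multi_unit_game :: "nat \<Rightarrow> (nat \<Rightarrow> nat) \<Rightarrow> bool" where
  "multi_unit_game N n \<longleftrightarrow> (\<forall>i\<in>{1..N}. n i > 0) \<and> mono_on {1..N} n"

definition strategies :: "nat \<Rightarrow> real list set" where
  "strategies k = {x. length x = k \<and> set x \<subseteq> {0..1} \<and> sorted_wrt (<) x}"

definition pure_profile :: "nat \<Rightarrow> (nat \<Rightarrow> nat) \<Rightarrow> (nat \<Rightarrow> real list) \<Rightarrow> bool" where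
  "pure_profile N n s \<longleftrightarrow> (\<forall>i\<in>{1..N}. s i \<in> strategies (n i))"

definition locations :: "nat \<Rightarrow> (nat \<Rightarrow> real list) \<Rightarrow> real set" where
  "locations N s = (\<Union>i\<in>{1..N}. set (s i))"

definition min_dist :: "real \<Rightarrow> real set \<Rightarrow> real" where
  "min_dist t A = (MIN f\<in>A. \<bar>t - f\<bar>)"

definition closest_players :: "nat \<Rightarrow> (nat \<Rightarrow> real list) \<Rightarrow> real \<Rightarrow> nat set" where
  "closest_players N s t = {i\<in>{1..N}. min_dist t (set (s i)) \<le> min_dist t (locations N s)}"

definition payoff :: "nat \<Rightarrow> (nat \<Rightarrow> real list) \<Rightarrow> nat \<Rightarrow> real" where
  "payoff N s i = integral {0..1}
     (\<lambda>t. of_bool (i \<in> closest_players N s t) / real (card (closest_players N s t)))"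

definition pure_nash :: "nat \<Rightarrow> (nat \<Rightarrow> nat) \<Rightarrow> (nat \<Rightarrow> real list) \<Rightarrow> bool" where
  "pure_nash N n s \<longleftrightarrow> pure_profile N n s \<and>
     (\<forall>i\<in>{1..N}. \<forall>x\<in>strategies (n i). \<not> payoff N (s(i := x)) i > payoff N s i)"

text \<open>
  The mass attracted to a facility at \<open>f\<close> does not depend on which of the players owning a
  facility at \<open>f\<close> is considered, so the player is not an argument.
\<close>

definition facility_mass :: "nat \<Rightarrow> (nat \<Rightarrow> real list) \<Rightarrow> real \<Rightarrow> real" where
  "facility_mass N s f = integral {0..1}
     (\<lambda>t. of_bool (\<bar>t - f\<bar> \<le> min_dist t (locations N s)) / real (card (closest_players N s t)))"

definition lone :: "nat \<Rightarrow> (nat \<Rightarrow> real list) \<Rightarrow> nat \<Rightarrow> real \<Rightarrow> bool" where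
  "lone N s i f \<longleftrightarrow> f \<in> set (s i) \<and> \<not> (\<exists>j\<in>{1..N}. j \<noteq> i \<and> f \<in> set (s j))"

definition neighbors :: "nat \<Rightarrow> (nat \<Rightarrow> real list) \<Rightarrow> real \<Rightarrow> real \<Rightarrow> bool" where
  "neighbors N s f1 f2 \<longleftrightarrow> f1 \<in> locations N s \<and> f2 \<in> locations N s \<and> f1 \<noteq> f2 \<and>
     {min f1 f2<..<max f1 f2} \<inter> locations N s = {}"

definition flat_players :: "nat \<Rightarrow> (nat \<Rightarrow> nat) \<Rightarrow> nat" where
  "flat_players N n = (\<Sum>i=1..N. n i)"

abbreviation flat_sizes :: "nat \<Rightarrow> nat" where
  "flat_sizes \<equiv> (\<lambda>_. 1)"

definition flattened_profile ::
  "nat \<Rightarrow> (nat \<Rightarrow> nat) \<Rightarrow> (nat \<Rightarrow> real list) \<Rightarrow> (nat \<Rightarrow> real list) \<Rightarrow> bool" where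
  "flattened_profile N n s s' \<longleftrightarrow> pure_profile (flat_players N n) flat_sizes s' \<and>
     (\<exists>M. bij_betw M (SIGMA i:{1..N}. {..<n i}) {1..flat_players N n} \<and>
          (\<forall>i\<in>{1..N}. \<forall>j<n i. s' (M (i, j)) = [s i ! j]))"

lemma flattened_profile_exists:
  assumes "pure_profile N n s"
  shows "\<exists>s'. flattened_profile N n s s'"
proof -
  let ?I = "SIGMA i:{1..N}. {..<n i}" and ?J = "{1..flat_players N n}"
  have "card ?I = card ?J"
    by (simp add: flat_players_def)
  then obtain M where M: "bij_betw M ?I ?J"
    using finite_same_card_bij[of ?I ?J] by blast
  define s' where "s' k = (case inv_into ?I M k of (i, j) \<Rightarrow> [s i ! j])" for k
  have s': "s' (M (i, j)) = [s i ! j]" if "i \<in> {1..N}" "j < n i" for i j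
    using that M by (simp add: s'_def bij_betw_def inv_into_f_f)
  have "s' k \<in> strategies 1" if k: "k \<in> ?J" for k
  proof -
    obtain i j where ij: "i \<in> {1..N}" "j < n i" "k = M (i, j)"
      using M k unfolding bij_betw_def by blast
    then have "s i \<in> strategies (n i)"
      using assms unfolding pure_profile_def by blast
    then have "s i ! j \<in> {0..1}"
      using ij(2) nth_mem[of j "s i"]
      unfolding strategies_def by (metis (mono_tags) mem_Collect_eq subsetD)
    then show ?thesis
      using s' ij by (simp add: strategies_def)
  qed
  then have "flattened_profile N n s s'"
    unfolding flattened_profile_def pure_profile_def using M s' by blast
  then show ?thesis
    by blast
qed

end

theory Submission
  imports Defs
begin

text \<open>
  Up to finitely many customers, a facility at \<open>p\<close> attracts the length of its Voronoi cell divided by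
  the number of its owners, and a payoff is the sum of the masses of the facilities. Fix a player \<open>i\<close>.
  Arbitrarily close to an opponent's location, on a chosen side, she can collect nearly a whole half of
  the cell there, without harming her other facilities. Hence a best response has equal masses \<open>v\<close>,
  every half cell is at most \<open>v\<close>, and no lone facility is next to another one of hers or endmost.
  Conversely, under these conditions every half cell of the opponents alone is at most \<open>v\<close> as well:
  when a lone facility is removed, the adjacent half cells of its neighbors grow to the length of its
  cell, which is \<open>v\<close>. So no facility of any
  deviation attracts more than \<open>v\<close>. Apart from the first two conditions of the theorem, which are
  void for single facilities, this characterization of equilibria depends only on the locations and
  the numbers of their owners, and so it does not change under flattening.
\<close>

section \<open>Voronoi cells and payoffs\<close>

text \<open>The lengths of the two halves of the cell of \<open>p\<close> in \<open>{0..1}\<close>. Since \<open>(p - q) / 2 \<le> p\<close> for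
  \<open>0 \<le> q\<close>, the inserted border term only matters if there is no facility on that side.\<close>

definition left_reach :: "real set \<Rightarrow> real \<Rightarrow> real" where
  "left_reach L p = Min (insert p ((\<lambda>q. (p - q) / 2) ` {q \<in> L. q < p}))"

definition right_reach :: "real set \<Rightarrow> real \<Rightarrow> real" where
  "right_reach L p = Min (insert (1 - p) ((\<lambda>q. (q - p) / 2) ` {q \<in> L. p < q}))"

lemma le_left_reach_iff:
  assumes "finite L"
  shows "r \<le> left_reach L p \<longleftrightarrow> r \<le> p \<and> (\<forall>q\<in>L. q < p \<longrightarrow> r \<le> (p - q) / 2)"
  using assms unfolding left_reach_def by (subst Min_ge_iff) auto

lemma le_right_reach_iff:
  assumes "finite L"
  shows "r \<le> right_reach L p \<longleftrightarrow> r \<le> 1 - p \<and> (\<forall>q\<in>L. p < q \<longrightarrow> r \<le> (q - p) / 2)"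
  using assms unfolding right_reach_def by (subst Min_ge_iff) auto

text \<open>Reflection at 1/2 exchanges the two directions. Together with \<open>reflect\<close>
  below, this transfers statements from one side to the other.\<close>

lemma left_reach_reflect:
  "left_reach ((-) 1 ` L) (1 - p) = right_reach L p"
proof -
  have "{q \<in> (-) 1 ` L. q < 1 - p} = (-) 1 ` {q \<in> L. p < q}"
    by auto
  then show ?thesis
    unfolding left_reach_def right_reach_def by (simp add: image_image)
qed

lemma right_reach_reflect:
  "right_reach ((-) 1 ` L) (1 - p) = left_reach L p"
  using left_reach_reflect[of "(-) 1 ` L" "1 - p"] by (simp add: image_image)

lemma left_reach_le:
  assumes "finite L"
  shows "left_reach L p \<le> p" and "q \<in> L \<Longrightarrow> q < p \<Longrightarrow> left_reach L p \<le> (p - q) / 2"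
  using assms le_left_reach_iff by blast+

lemma right_reach_le:
  assumes "finite L"
  shows "right_reach L p \<le> 1 - p" and "q \<in> L \<Longrightarrow> p < q \<Longrightarrow> right_reach L p \<le> (q - p) / 2"
  using assms le_right_reach_iff by blast+

lemma left_reach_nonneg: "finite L \<Longrightarrow> 0 \<le> p \<Longrightarrow> 0 \<le> left_reach L p"
  by (subst le_left_reach_iff) auto

lemma right_reach_nonneg: "finite L \<Longrightarrow> p \<le> 1 \<Longrightarrow> 0 \<le> right_reach L p"
  by (subst le_right_reach_iff) auto

lemma left_reach_antimono: "finite L' \<Longrightarrow> L \<subseteq> L' \<Longrightarrow> left_reach L' p \<le> left_reach L p"
  using left_reach_le(1)[of L' p] left_reach_le(2)[of L' _ p] by (subst le_left_reach_iff) (auto intro: finite_subset)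

lemma right_reach_antimono: "finite L' \<Longrightarrow> L \<subseteq> L' \<Longrightarrow> right_reach L' p \<le> right_reach L p"
  using right_reach_le(1)[of L' p] right_reach_le(2)[of L' _ p] by (subst le_right_reach_iff) (auto intro: finite_subset)

lemma left_reach_eq_gap:
  assumes "finite L" "L \<subseteq> {0..1}" "a \<in> L" "a < p" "{a<..<p} \<inter> L = {}"
  shows "left_reach L p = (p - a) / 2"
proof (rule antisym)
  have "q \<le> a" if "q \<in> L" "q < p" for q
    using assms(5) that by (meson disjoint_iff greaterThanLessThan_iff not_le_imp_less)
  then show "(p - a) / 2 \<le> left_reach L p"
    using assms by (subst le_left_reach_iff) force+
qed (use assms left_reach_le in blast)

lemma right_reach_eq_gap:
  assumes "finite L" "L \<subseteq> {0..1}" "b \<in> L" "p < b" "{p<..<b} \<inter> L = {}"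
  shows "right_reach L p = (b - p) / 2"
proof (rule antisym)
  have "b \<le> q" if "q \<in> L" "p < q" for q
    using assms(5) that by (meson disjoint_iff greaterThanLessThan_iff not_le_imp_less)
  then show "(b - p) / 2 \<le> right_reach L p"
    using assms by (subst le_right_reach_iff) force+
qed (use assms right_reach_le in blast)

lemma left_reach_eq_end: "finite L \<Longrightarrow> \<not> (\<exists>q\<in>L. q < p) \<Longrightarrow> left_reach L p = p"
  by (rule antisym, simp add: left_reach_le, subst le_left_reach_iff) auto

lemma right_reach_eq_end: "finite L \<Longrightarrow> \<not> (\<exists>q\<in>L. p < q) \<Longrightarrow> right_reach L p = 1 - p"
  by (rule antisym, simp add: right_reach_le, subst le_right_reach_iff) auto

section \<open>Cells as sets of nearest customers, and their masses\<close>

lemma le_min_dist_iff: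
  assumes "finite L" "L \<noteq> {}"
  shows "r \<le> min_dist t L \<longleftrightarrow> (\<forall>q\<in>L. r \<le> \<bar>t - q\<bar>)"
  using assms by (simp add: min_dist_def)

lemma min_dist_le_iff:
  assumes "finite L" "L \<noteq> {}"
  shows "min_dist t L \<le> r \<longleftrightarrow> (\<exists>q\<in>L. \<bar>t - q\<bar> \<le> r)"
  using assms unfolding min_dist_def by (subst Min_le_iff) auto

text \<open>The customers at least as close to \<open>p\<close> as to \<open>q\<close> are those on
  the side of \<open>p\<close> of the midpoint. Intersecting these half lines over all
  \<open>q\<close> gives the cell, and \<open>t \<in> {0..1}\<close> accounts for the border terms
  of the reaches.\<close>

lemma nearest_iff_reach:
  assumes L: "finite L" "p \<in> L" and t: "t \<in> {0..1}"
  shows "\<bar>t - p\<bar> \<le> min_dist t L \<longleftrightarrow> p - left_reach L p \<le> t \<and> t \<le> p + right_reach L p"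
proof -
  have *: "\<bar>t - p\<bar> \<le> \<bar>t - q\<bar> \<longleftrightarrow> (q < p \<longrightarrow> p - t \<le> (p - q) / 2) \<and> (p < q \<longrightarrow> t - p \<le> (q - p) / 2)" for q
    by (auto simp: abs_if field_simps)
  have reach: "p - left_reach L p \<le> t \<longleftrightarrow> p - t \<le> left_reach L p"
    "t \<le> p + right_reach L p \<longleftrightarrow> t - p \<le> right_reach L p"
    by auto
  have "L \<noteq> {}"
    using L by blast
  then show ?thesis
    using t by (simp only: reach le_left_reach_iff[OF L(1)] le_right_reach_iff[OF L(1)] le_min_dist_iff[OF L(1) \<open>L \<noteq> {}\<close>] *) auto
qed

definition owners :: "nat \<Rightarrow> (nat \<Rightarrow> real list) \<Rightarrow> real \<Rightarrow> nat set" where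
  "owners N s p = {i \<in> {1..N}. p \<in> set (s i)}"

lemma finite_locations [simp]: "finite (locations N s)"
  by (simp add: locations_def)

text \<open>Strictly inside the cell every other location is farther away than \<open>p\<close>, so
  the closest players are exactly the owners of \<open>p\<close>; beyond its ends the integrand is
  0. Ties at the two end points do not affect the integral. Strategies are nonempty because
  \<open>min_dist\<close> is a minimum over the facilities.\<close>

lemma facility_mass_has_integral:
  assumes ne: "\<And>i. i \<in> {1..N} \<Longrightarrow> s i \<noteq> []"
    and p: "p \<in> locations N s" and L01: "locations N s \<subseteq> {0..1}"
  shows "((\<lambda>t. of_bool (\<bar>t - p\<bar> \<le> min_dist t (locations N s)) / real (card (closest_players N s t)))
     has_integral (left_reach (locations N s) p + right_reach (locations N s) p)
       / real (card (owners N s p))) {0..1}"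
proof -
  let ?L = "locations N s"
  let ?a = "p - left_reach ?L p" and ?b = "p + right_reach ?L p"
  let ?k = "1 / real (card (owners N s p))"
  have p01: "0 \<le> p" "p \<le> 1"
    using p L01 by auto
  have ab: "0 \<le> ?a" "?a \<le> ?b" "?b \<le> 1"
    using left_reach_le(1)[of ?L p] right_reach_le(1)[of ?L p]
      left_reach_nonneg[of ?L p] right_reach_nonneg[of ?L p] p01 by auto
  have "closest_players N s t = owners N s p" if t: "?a < t" "t < ?b" for t
  proof -
    have t01: "t \<in> {0..1}"
      using that ab by auto
    have near: "\<bar>t - p\<bar> \<le> min_dist t ?L"
      using nearest_iff_reach[of ?L p t] p t t01 by auto
    have far: "\<bar>t - p\<bar> < \<bar>t - q\<bar>" if q: "q \<in> ?L" "q \<noteq> p" for q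
    proof (cases "q < p")
      case True
      then show ?thesis
        using left_reach_le(2)[of ?L q p] q t by (auto simp: abs_if field_simps)
    next
      case False
      then show ?thesis
        using right_reach_le(2)[of ?L q p] q t by (auto simp: abs_if field_simps)
    qed
    have md: "min_dist t ?L = \<bar>t - p\<bar>"
      using near min_dist_le_iff[of ?L t "\<bar>t - p\<bar>"] p by (intro antisym) auto
    have "min_dist t (set (s i)) \<le> \<bar>t - p\<bar> \<longleftrightarrow> p \<in> set (s i)" if i: "i \<in> {1..N}" for i
    proof -
      have "set (s i) \<subseteq> ?L"
        using i by (auto simp: locations_def)
      then show ?thesis
        using min_dist_le_iff[of "set (s i)" t "\<bar>t - p\<bar>"] ne[OF i] far by (force simp: subset_iff)
    qed
    then show ?thesis
      by (auto simp: closest_players_def owners_def md)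
  qed
  then have eq: "of_bool (\<bar>t - p\<bar> \<le> min_dist t ?L) / real (card (closest_players N s t))
      = (if t \<in> {?a..?b} then ?k else 0)" if "t \<in> {0..1} - {?a, ?b}" for t
    using nearest_iff_reach[of ?L p t] p that by auto
  have "((\<lambda>t. ?k) has_integral (?b - ?a) * ?k) {?a..?b}"
    using has_integral_const_real[of ?k ?a ?b] ab by simp
  then have int: "((\<lambda>t. if t \<in> {?a..?b} then ?k else 0) has_integral (?b - ?a) * ?k) {0..1}"
    using ab by (subst has_integral_restrict) auto
  have "(?b - ?a) * ?k = (left_reach ?L p + right_reach ?L p) / real (card (owners N s p))"
    by (simp add: add.commute)
  then have *: "((\<lambda>t. if t \<in> {?a..?b} then ?k else 0) has_integral
      (left_reach ?L p + right_reach ?L p) / real (card (owners N s p))) {0..1}"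
    using int by (simp only:)
  show ?thesis
  proof (rule has_integral_spike_finite[OF _ _ *])
    show "finite {?a, ?b}"
      by simp
  qed (rule eq)
qed

lemma facility_mass_eq:
  assumes "\<And>i. i \<in> {1..N} \<Longrightarrow> s i \<noteq> []"
    and "p \<in> locations N s" and "locations N s \<subseteq> {0..1}"
  shows "facility_mass N s p =
    (left_reach (locations N s) p + right_reach (locations N s) p) / real (card (owners N s p))"
  unfolding facility_mass_def using facility_mass_has_integral[OF assms] by (rule integral_unique)

text \<open>A customer served by a player counts once, however many of her facilities are nearest.
  Two of them can be nearest only at their midpoint, so outside a finite set exactly one summand is
  nonzero for such a customer.\<close>

lemma payoff_eq_sum_mass:
  assumes ne: "\<And>i. i \<in> {1..N} \<Longrightarrow> s i \<noteq> []"
    and L01: "locations N s \<subseteq> {0..1}" and i: "i \<in> {1..N}"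
  shows "payoff N s i = (\<Sum>p\<in>set (s i). facility_mass N s p)"
proof -
  let ?L = "locations N s"
  let ?g = "\<lambda>t p. of_bool (\<bar>t - p\<bar> \<le> min_dist t ?L) / real (card (closest_players N s t))"
  let ?mid = "(\<lambda>(p, q). (p + q) / 2) ` (?L \<times> ?L)"
  have sub: "set (s i) \<subseteq> ?L"
    using i by (auto simp: locations_def)
  have *: "((\<lambda>t. \<Sum>p\<in>set (s i). ?g t p) has_integral (\<Sum>p\<in>set (s i). facility_mass N s p)) {0..1}"
  proof (rule has_integral_sum)
    fix p assume "p \<in> set (s i)"
    then have "p \<in> ?L"
      using sub by blast
    then show "((\<lambda>t. ?g t p) has_integral facility_mass N s p) {0..1}"
      using facility_mass_has_integral[OF ne _ L01] facility_mass_eq[OF ne _ L01] by simp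
  qed simp
  have eq: "of_bool (i \<in> closest_players N s t) / real (card (closest_players N s t))
      = (\<Sum>p\<in>set (s i). ?g t p)" if t: "t \<in> {0..1} - ?mid" for t
  proof (cases "\<exists>p\<in>set (s i). \<bar>t - p\<bar> \<le> min_dist t ?L")
    case True
    then obtain p where p: "p \<in> set (s i)" "\<bar>t - p\<bar> \<le> min_dist t ?L"
      by blast
    have "q = p" if "q \<in> set (s i)" "\<bar>t - q\<bar> \<le> min_dist t ?L" for q
    proof (rule ccontr)
      assume "q \<noteq> p"
      have "p \<in> ?L" "q \<in> ?L"
        using p that sub by auto
      moreover from this have "min_dist t ?L \<le> \<bar>t - p\<bar>" "min_dist t ?L \<le> \<bar>t - q\<bar>"
        by (auto simp: min_dist_def)
      then have "\<bar>t - q\<bar> = \<bar>t - p\<bar>"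
        using p(2) that(2) by simp
      then have "t = (p + q) / 2"
        using \<open>q \<noteq> p\<close> by (auto simp: abs_if split: if_splits)
      ultimately have "t \<in> ?mid"
        by (intro image_eqI[of _ _ "(p, q)"]) auto
      then show False
        using t by blast
    qed
    then have "\<forall>q\<in>set (s i) - {p}. ?g t q = 0"
      by auto
    then have "(\<Sum>q\<in>set (s i). ?g t q) = (\<Sum>q\<in>{p}. ?g t q)"
      using p(1) by (intro sum.mono_neutral_right) simp_all
    moreover have "i \<in> closest_players N s t"
      using p i ne[OF i] min_dist_le_iff[of "set (s i)" t "min_dist t ?L"]
      by (auto simp: closest_players_def)
    ultimately show ?thesis
      using p by simp
  next
    case False
    then have "i \<notin> closest_players N s t"
      using ne[OF i] min_dist_le_iff[of "set (s i)" t "min_dist t ?L"] by (auto simp: closest_players_def)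
    then show ?thesis
      using False by simp
  qed
  show ?thesis
    unfolding payoff_def
  proof (rule integral_unique, rule has_integral_spike_finite[OF _ _ *])
    show "finite ?mid"
      by simp
  qed (rule eq)
qed

section \<open>Best responses of one player\<close>

text \<open>The set of the locations of the opponents of a player and the number of opponents at each point.\<close>

locale opponents =
  fixes A :: "real set" and m :: "real \<Rightarrow> nat"
  assumes finite_A [simp]: "finite A" and A01: "A \<subseteq> {0..1}" and A_nonempty: "A \<noteq> {}"
    and m_pos_iff: "0 < m p \<longleftrightarrow> p \<in> A"
begin

text \<open>The added 1 counts the player herself. Since the reaches ignore a facility at
  \<open>p\<close>, the formula is also meaningful for \<open>p \<notin> X\<close>: it is then what
  a further facility at \<open>p\<close> would attract.\<close>

definition share :: "real set \<Rightarrow> real \<Rightarrow> real" where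
  "share X p = (left_reach (A \<union> X) p + right_reach (A \<union> X) p) / (real (m p) + 1)"

definition total :: "real set \<Rightarrow> real" where
  "total X = (\<Sum>p\<in>X. share X p)"

text \<open>A strictly increasing list is determined by its set of entries, so strategies enter as
  finite sets, and \<open>card\<close> replaces the length.\<close>

definition best_response :: "real set \<Rightarrow> bool" where
  "best_response X \<longleftrightarrow>
     (\<forall>Y. finite Y \<and> Y \<subseteq> {0..1} \<and> card Y = card X \<longrightarrow> total Y \<le> total X)"

text \<open>The mirror image is again an instance of the locale. It is interpreted under the name
  \<open>r\<close> below whenever a statement is carried over to the other side.\<close>

lemma reflect: "opponents ((-) 1 ` A) (\<lambda>p. m (1 - p))"
proof
  show "0 < m (1 - p) \<longleftrightarrow> p \<in> (-) 1 ` A" for p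
    by (subst m_pos_iff) (auto intro: image_eqI[of _ _ "1 - p"])
qed (use A01 A_nonempty in auto)

lemma share_reflect: "opponents.share ((-) 1 ` A) (\<lambda>p. m (1 - p)) ((-) 1 ` X) (1 - p) = share X p"
proof -
  interpret r: opponents "(-) 1 ` A" "\<lambda>p. m (1 - p)"
    by (rule reflect)
  have "(-) 1 ` A \<union> (-) 1 ` X = (-) 1 ` (A \<union> X)"
    by blast
  then show ?thesis
    by (simp add: share_def r.share_def left_reach_reflect right_reach_reflect add.commute)
qed

lemma total_reflect: "opponents.total ((-) 1 ` A) (\<lambda>p. m (1 - p)) ((-) 1 ` X) = total X"
proof -
  interpret r: opponents "(-) 1 ` A" "\<lambda>p. m (1 - p)"
    by (rule reflect)
  show ?thesis
    unfolding total_def r.total_def by (subst sum.reindex) (auto simp: inj_on_def share_reflect)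
qed

lemma best_response_reflect:
  assumes "best_response X"
  shows "opponents.best_response ((-) 1 ` A) (\<lambda>p. m (1 - p)) ((-) 1 ` X)"
proof -
  interpret r: opponents "(-) 1 ` A" "\<lambda>p. m (1 - p)"
    by (rule reflect)
  have "r.total Y \<le> r.total ((-) 1 ` X)"
    if Y: "finite Y" "Y \<subseteq> {0..1}" "card Y = card ((-) 1 ` X)" for Y
  proof -
    have "card ((-) 1 ` Z) = card Z" for Z :: "real set"
      by (rule card_image) (simp add: inj_on_def)
    then have "finite ((-) 1 ` Y) \<and> (-) 1 ` Y \<subseteq> {0..1} \<and> card ((-) 1 ` Y) = card X"
      using Y by (auto simp: subset_iff)
    then have "total ((-) 1 ` Y) \<le> total X"
      using assms unfolding best_response_def by blast
    then show ?thesis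
      using total_reflect[of X] total_reflect[of "(-) 1 ` Y"] by (simp add: image_image)
  qed
  then show ?thesis
    unfolding r.best_response_def by blast
qed

section \<open>Effect of withdrawing and adding own facilities\<close>

lemma share_nonneg: "finite X \<Longrightarrow> p \<in> {0..1} \<Longrightarrow> 0 \<le> share X p"
  using left_reach_nonneg[of "A \<union> X" p] right_reach_nonneg[of "A \<union> X" p] by (simp add: share_def)

lemma share_antimono:
  assumes "finite X" "Z \<subseteq> X"
  shows "share X p \<le> share Z p"
proof -
  have "A \<union> Z \<subseteq> A \<union> X"
    using assms by blast
  then show ?thesis
    using left_reach_antimono[of "A \<union> X" "A \<union> Z" p] right_reach_antimono[of "A \<union> X" "A \<union> Z" p] assms
    by (auto simp: share_def intro!: divide_right_mono)
qed

lemma share_lone: "p \<notin> A \<Longrightarrow> share X p = left_reach (A \<union> X) p + right_reach (A \<union> X) p"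
  using m_pos_iff[of p] by (simp add: share_def)

lemma m_ge_1_of_mem: "p \<in> A \<Longrightarrow> 1 \<le> real (m p)"
  using m_pos_iff[of p] by simp

text \<open>The withdrawn shares are lost, and no remaining share decreases. The growth at one
  remaining facility \<open>h\<close> is kept, because some deviations below are profitable only
  thanks to it.\<close>

lemma total_remove:
  assumes X: "finite X" and R: "R \<subseteq> X" and h: "h \<in> X - R"
  shows "total X - (\<Sum>p\<in>R. share X p) + (share (X - R) h - share X h) \<le> total (X - R)"
proof -
  have fin: "finite (X - R)" "finite R"
    using X R finite_subset by auto
  have "total X = (\<Sum>p\<in>R. share X p) + (\<Sum>p\<in>X - R. share X p)"
    unfolding total_def using X R by (simp add: sum.subset_diff add.commute)
  moreover have "(\<Sum>p\<in>X - R. share X p) = share X h + (\<Sum>p\<in>X - R - {h}. share X p)"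
    "total (X - R) = share (X - R) h + (\<Sum>p\<in>X - R - {h}. share (X - R) p)"
    unfolding total_def using fin h by (simp_all add: sum.remove)
  moreover have "(\<Sum>p\<in>X - R - {h}. share X p) \<le> (\<Sum>p\<in>X - R - {h}. share (X - R) p)"
    using X by (intro sum_mono share_antimono) auto
  ultimately show ?thesis
    by simp
qed

lemma total_remove_le:
  assumes X: "finite X" and R: "R \<subseteq> X"
  shows "total X - (\<Sum>p\<in>R. share X p) \<le> total (X - R)"
proof (cases "X - R = {}")
  case True
  then have "R = X"
    using R by blast
  then show ?thesis
    by (simp add: total_def)
next
  case False
  then obtain h where h: "h \<in> X - R"
    by blast
  then show ?thesis
    using total_remove[OF X R h] share_antimono[OF X, of "X - R" h] by simp
qed

text \<open>The new facility adds no location, so all own shares stay as they are. This serves for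
  \<open>q\<close> at the border, where no room is left beside it and the half cell on that side has
  length 0.\<close>

lemma total_insert_shared:
  assumes "finite X" "q \<in> A - X"
  shows "total X \<le> total (insert q X)"
proof -
  have "A \<union> insert q X = A \<union> X"
    using assms by blast
  then have "share (insert q X) = share X"
    by (simp add: share_def fun_eq_iff)
  then show ?thesis
    using assms share_nonneg[of X q] A01 by (auto simp: total_def)
qed

text \<open>The facility at \<open>y\<close> takes over the right half of the cell of \<open>q\<close>, and \<open>\<delta>\<close> bounds what is lost
  by moving it away from \<open>q\<close>.\<close>

lemma insert_right_of:
  assumes X: "finite X" "X \<subseteq> {0..1}" and q: "q \<in> A - X" "q < 1" and d: "0 < \<delta>"
  obtains y where "q < y" "y \<in> {0..1}" "y \<notin> A \<union> X"
    "total X + right_reach (A \<union> X) q - \<delta> \<le> total (insert y X)"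
    "\<And>p. p \<in> A \<union> X \<Longrightarrow> left_reach (A \<union> X) p - \<delta> \<le> left_reach (A \<union> insert y X) p"
proof -
  let ?L = "A \<union> X"
  have fL: "finite ?L"
    using X by simp
  define b where "b = Min (insert 1 {p \<in> ?L. q < p})"
  have b: "q < b" "b \<le> 1" "\<And>p. p \<in> ?L \<Longrightarrow> q < p \<Longrightarrow> b \<le> p"
    using fL q by (auto simp: b_def)
  \<comment> \<open>The first bound keeps \<open>y\<close> strictly before the next location or the
    border. The second one pays for a loss of at most \<open>\<epsilon>\<close> at each of the
    \<open>card X\<close> old facilities and at the new one.\<close>
  define \<epsilon> where "\<epsilon> = min ((b - q) / 2) (\<delta> / (real (card X) + 1))"
  define y where "y = q + \<epsilon>"
  have e: "0 < \<epsilon>" "\<epsilon> * (real (card X) + 1) \<le> \<delta>" "\<epsilon> \<le> \<delta>"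
  proof -
    show "0 < \<epsilon>"
      using b d by (simp add: \<epsilon>_def)
    then show *: "\<epsilon> * (real (card X) + 1) \<le> \<delta>"
      by (simp add: \<epsilon>_def pos_le_divide_eq[symmetric])
    have "\<epsilon> * 1 \<le> \<epsilon> * (real (card X) + 1)"
      using \<open>0 < \<epsilon>\<close> by (intro mult_left_mono) auto
    then show "\<epsilon> \<le> \<delta>"
      using * by simp
  qed
  have y: "q < y" "y < b"
  proof -
    have "\<epsilon> \<le> (b - q) / 2"
      unfolding \<epsilon>_def by (rule min.cobounded1)
    then show "q < y" "y < b"
      using e b by (simp_all add: y_def)
  qed
  then have yL: "y \<notin> ?L" "\<And>p. p \<in> ?L \<Longrightarrow> p \<le> q \<or> y < p"
    using b(3) by force+
  have qL: "q \<in> ?L" "0 \<le> q" "q \<in> A"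
    using q A01 by auto
  \<comment> \<open>Only facilities beyond \<open>y\<close> can lose on their left. Their half cells
    were already bounded by \<open>q\<close>, and replacing \<open>q\<close> by \<open>y\<close>
    costs at most \<open>\<epsilon> / 2\<close>.\<close>
  have left: "left_reach ?L p - \<epsilon> / 2 \<le> left_reach (insert y ?L) p" if p: "p \<in> ?L" for p
  proof -
    have "left_reach ?L p - \<epsilon> / 2 \<le> (p - y) / 2" if "y < p"
      using left_reach_le(2)[OF fL qL(1), of p] y that by (simp add: y_def field_simps)
    moreover have "left_reach ?L p - \<epsilon> / 2 \<le> (p - r) / 2"
        if "r \<in> ?L" "r < p" for r
      using left_reach_le(2)[OF fL that] e by simp
    moreover have "left_reach ?L p - \<epsilon> / 2 \<le> p"
      using left_reach_le(1)[OF fL, of p] e by simp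
    ultimately show ?thesis
      using fL by (subst le_left_reach_iff) auto
  qed
  \<comment> \<open>To the left of \<open>y\<close>, the nearer \<open>q\<close> is already a bound.
    The right half cell of \<open>q\<close> itself does shrink, but \<open>q\<close> is not an own
    facility.\<close>
  have right: "right_reach ?L p \<le> right_reach (insert y ?L) p" if p: "p \<in> ?L" "p \<noteq> q" for p
  proof -
    have "right_reach ?L p \<le> (y - p) / 2" if "p < y"
      using right_reach_le(2)[OF fL qL(1), of p] yL(2)[of p] y that p by (force simp: field_simps)
    moreover have "right_reach ?L p \<le> (r - p) / 2" if "r \<in> ?L" "p < r" for r
      using right_reach_le(2)[OF fL that] .
    moreover have "right_reach ?L p \<le> 1 - p"
      using right_reach_le(1)[OF fL, of p] .
    ultimately show ?thesis
      using fL by (subst le_right_reach_iff) auto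
  qed
  have new: "share (insert y X) y \<ge> right_reach ?L q - \<epsilon>"
  proof -
    have y01: "0 \<le> y" "y \<le> 1"
      using y b qL by auto
    have "right_reach ?L q - \<epsilon> \<le> 1 - y"
      using right_reach_le(1)[OF fL, of q] by (simp add: y_def)
    moreover have "right_reach ?L q - \<epsilon> \<le> (p - y) / 2" if "p \<in> insert y ?L" "y < p" for p
      using right_reach_le(2)[OF fL, of p q] that y e by (auto simp: y_def field_simps)
    ultimately have "right_reach ?L q - \<epsilon> \<le> right_reach (insert y ?L) y"
      using fL by (subst le_right_reach_iff) auto
    then show ?thesis
      using left_reach_nonneg[of "insert y ?L" y] fL y01 yL by (simp add: share_lone)
  qed
  have old: "share X p - \<epsilon> \<le> share (insert y X) p" if p: "p \<in> X" for p
  proof -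
    have "p \<in> ?L" "p \<noteq> q"
      using p q by auto
    then have "left_reach ?L p + right_reach ?L p
        \<le> left_reach (insert y ?L) p + right_reach (insert y ?L) p + \<epsilon> / 2"
      using left right by fastforce
    then have "share X p \<le> (left_reach (insert y ?L) p + right_reach (insert y ?L) p + \<epsilon> / 2) / (real (m p) + 1)"
      unfolding share_def by (intro divide_right_mono) auto
    also have "\<dots> = share (insert y X) p + \<epsilon> / 2 / (real (m p) + 1)"
      by (simp add: share_def add_divide_distrib)
    also have "\<epsilon> / 2 / (real (m p) + 1) \<le> \<epsilon> / 2"
      using e by (simp add: field_simps)
    finally show ?thesis
      using e by simp
  qed
  have "total X - real (card X) * \<epsilon> = (\<Sum>p\<in>X. share X p - \<epsilon>)"
    by (simp add: total_def sum_subtractf)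
  also have "\<dots> \<le> (\<Sum>p\<in>X. share (insert y X) p)"
    by (rule sum_mono) (rule old)
  finally have "total X - real (card X) * \<epsilon> + (right_reach ?L q - \<epsilon>) \<le> total (insert y X)"
    using new X yL by (simp add: total_def)
  then have "total X + right_reach ?L q - \<delta> \<le> total (insert y X)"
    using e(2) by (simp add: algebra_simps)
  moreover have "left_reach ?L p - \<delta> \<le> left_reach (A \<union> insert y X) p" if "p \<in> ?L" for p
    using left[OF that] e by simp
  moreover have "y \<in> {0..1}"
    using y b qL by auto
  ultimately show ?thesis
    using that y yL by blast
qed

lemma insert_left_of:
  assumes X: "finite X" "X \<subseteq> {0..1}" and q: "q \<in> A - X" "0 < q" and d: "0 < \<delta>"
  obtains y where "y < q" "y \<in> {0..1}" "y \<notin> A \<union> X"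
    "total X + left_reach (A \<union> X) q - \<delta> \<le> total (insert y X)"
proof -
  interpret r: opponents "(-) 1 ` A" "\<lambda>p. m (1 - p)"
    by (rule reflect)
  let ?X = "(-) 1 ` X"
  have un: "(-) 1 ` A \<union> ?X = (-) 1 ` (A \<union> X)"
    by blast
  have "finite ?X" "?X \<subseteq> {0..1}" "1 - q \<in> (-) 1 ` A - ?X" "1 - q < 1"
    using X q by auto
  then obtain y where y: "1 - q < y" "y \<in> {0..1}" "y \<notin> (-) 1 ` A \<union> ?X"
    "r.total ?X + right_reach ((-) 1 ` A \<union> ?X) (1 - q) - \<delta> \<le> r.total (insert y ?X)"
    using d by (rule r.insert_right_of)
  have "insert y ?X = (-) 1 ` insert (1 - y) X"
    by simp
  then have "total X + left_reach (A \<union> X) q - \<delta> \<le> total (insert (1 - y) X)"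
    using y(4) by (simp only: un total_reflect right_reach_reflect)
  moreover have "1 - y \<notin> A \<union> X"
    using y(3) by (auto intro: image_eqI[of y _ "1 - y"])
  ultimately show ?thesis
    using that[of "1 - y"] y by auto
qed

text \<open>Withdrawing \<open>x\<close> and entering just right of \<open>q\<close> comes within
  every \<open>\<delta>\<close> of the left side. For \<open>q = 1\<close> the facility is put on
  \<open>q\<close> instead. The choice \<open>x = q\<close> is allowed: an own facility at
  \<open>q\<close> can itself be the one that moves.\<close>

lemma best_response_replace_right:
  assumes X: "best_response X" "finite X" "X \<subseteq> {0..1}" and x: "x \<in> X"
    and q: "q \<in> A" "q \<notin> X - {x}"
  shows "total (X - {x}) + right_reach (A \<union> (X - {x})) q \<le> total X"
proof (rule field_le_epsilon)
  fix \<delta> :: real assume d: "0 < \<delta>"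
  let ?Z = "X - {x}"
  have Z: "finite ?Z" "?Z \<subseteq> {0..1}" "q \<in> A - ?Z"
    using X q by auto
  have "\<exists>y. y \<in> {0..1} - ?Z \<and> total ?Z + right_reach (A \<union> ?Z) q - \<delta> \<le> total (insert y ?Z)"
  proof (cases "q < 1")
    case True
    obtain y where "y \<in> {0..1}" "y \<notin> A \<union> ?Z"
      "total ?Z + right_reach (A \<union> ?Z) q - \<delta> \<le> total (insert y ?Z)"
      using insert_right_of[OF Z True d] by metis
    then show ?thesis
      by blast
  next
    case False
    then have "right_reach (A \<union> ?Z) q \<le> 0"
      using right_reach_le(1)[of "A \<union> ?Z" q] Z by simp
    then show ?thesis
      using total_insert_shared[OF Z(1,3)] Z(3) A01 d by (intro exI[of _ q]) auto
  qed
  then obtain y where y: "y \<in> {0..1} - ?Z" "total ?Z + right_reach (A \<union> ?Z) q - \<delta> \<le> total (insert y ?Z)"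
    by blast
  have "card (insert y ?Z) = card X"
    using y(1) Z(1) card_Suc_Diff1[OF X(2) x] by simp
  moreover have "finite (insert y ?Z)" "insert y ?Z \<subseteq> {0..1}"
    using y(1) Z by auto
  ultimately have "total (insert y ?Z) \<le> total X"
    using X(1) unfolding best_response_def by blast
  then show "total ?Z + right_reach (A \<union> ?Z) q \<le> total X + \<delta>"
    using y(2) by simp
qed

lemma best_response_replace_left:
  assumes X: "best_response X" "finite X" "X \<subseteq> {0..1}" and x: "x \<in> X"
    and q: "q \<in> A" "q \<notin> X - {x}"
  shows "total (X - {x}) + left_reach (A \<union> (X - {x})) q \<le> total X"
proof -
  interpret r: opponents "(-) 1 ` A" "\<lambda>p. m (1 - p)"
    by (rule reflect)
  have *: "(-) 1 ` X - {1 - x} = (-) 1 ` (X - {x})"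
    "(-) 1 ` A \<union> (-) 1 ` (X - {x}) = (-) 1 ` (A \<union> (X - {x}))"
    by auto
  have "r.total ((-) 1 ` X - {1 - x}) + right_reach ((-) 1 ` A \<union> ((-) 1 ` X - {1 - x})) (1 - q)
      \<le> r.total ((-) 1 ` X)"
  proof (rule r.best_response_replace_right)
    show "r.best_response ((-) 1 ` X)"
      by (rule best_response_reflect[OF X(1)])
  qed (use X x q in auto)
  then show ?thesis
    by (simp only: * total_reflect right_reach_reflect)
qed

text \<open>One facility enters right of \<open>q\<close>, then the other left of \<open>q'\<close>;
  the last property in \<open>insert_right_of\<close> ensures that the first hardly shortens the
  half cell wanted by the second. With \<open>q = q'\<close>, the two enclose one location and
  collect both of its halves. The assumption \<open>q \<le> q'\<close> excludes \<open>q = 1\<close>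
  together with \<open>q' = 0\<close>.\<close>

lemma best_response_replace_two:
  assumes X: "best_response X" "finite X" "X \<subseteq> {0..1}" and x: "x \<in> X" "x' \<in> X" "x \<noteq> x'"
    and q: "q \<in> A" "q \<notin> X - {x, x'}" "q' \<in> A" "q' \<notin> X - {x, x'}" "q \<le> q'"
  shows "total (X - {x, x'}) + right_reach (A \<union> (X - {x, x'})) q + left_reach (A \<union> (X - {x, x'})) q'
    \<le> total X"
proof (rule field_le_epsilon)
  fix \<delta> :: real assume d: "0 < \<delta>"
  let ?Z = "X - {x, x'}"
  let ?v = "total ?Z + right_reach (A \<union> ?Z) q + left_reach (A \<union> ?Z) q'"
  have Z: "finite ?Z" "?Z \<subseteq> {0..1}" and qZ: "q \<in> A - ?Z" "q' \<in> A - ?Z"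
    using X q by auto
  have q01: "0 \<le> q" "q \<le> 1" "0 \<le> q'" "q' \<le> 1"
    using q A01 by auto
  have "\<exists>y z. y \<in> {0..1} - ?Z \<and> z \<in> {0..1} - ?Z \<and> y \<noteq> z \<and> ?v - \<delta> \<le> total (insert z (insert y ?Z))"
  proof (cases "q < 1")
    case True
    have "0 < \<delta> / 3"
      using d by simp
    then obtain y where y: "q < y" "y \<in> {0..1}" "y \<notin> A \<union> ?Z"
      "total ?Z + right_reach (A \<union> ?Z) q - \<delta> / 3 \<le> total (insert y ?Z)"
      "\<And>p. p \<in> A \<union> ?Z \<Longrightarrow> left_reach (A \<union> ?Z) p - \<delta> / 3 \<le> left_reach (A \<union> insert y ?Z) p"
      using insert_right_of[OF Z qZ(1) True] by metis
    have Y: "finite (insert y ?Z)" "insert y ?Z \<subseteq> {0..1}" "q' \<in> A - insert y ?Z"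
      using Z y qZ by auto
    show ?thesis
    proof (cases "0 < q'")
      case True
      obtain z where z: "z \<in> {0..1}" "z \<notin> A \<union> insert y ?Z"
        "total (insert y ?Z) + left_reach (A \<union> insert y ?Z) q' - \<delta> / 3 \<le> total (insert z (insert y ?Z))"
        using insert_left_of[OF Y True \<open>0 < \<delta> / 3\<close>] by metis
      have "?v - \<delta> \<le> total (insert z (insert y ?Z))"
        using y(4) y(5)[of q'] z(3) qZ(2) by fastforce
      then show ?thesis
        using y(2,3) z(1,2) by blast
    next
      case False
      then have "left_reach (A \<union> ?Z) q' \<le> 0"
        using left_reach_le(1)[of "A \<union> ?Z" q'] Z by simp
      then have "?v - \<delta> \<le> total (insert q' (insert y ?Z))"
        using y(4) total_insert_shared[OF Y(1,3)] d by simp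
      then show ?thesis
        using y(2,3) Y(3) q01 by (intro exI[of _ y] exI[of _ q']) auto
    qed
  next
    \<comment> \<open>At \<open>q = 1\<close> there is nothing to collect on the right, so one
      facility is placed on \<open>q\<close> itself after the other one has entered left of
      \<open>q'\<close>.\<close>
    case False
    then have "right_reach (A \<union> ?Z) q \<le> 0"
      using right_reach_le(1)[of "A \<union> ?Z" q] Z by simp
    moreover have "0 < q'"
      using False q01 q by simp
    moreover obtain z where z: "z \<in> {0..1}" "z \<notin> A \<union> ?Z"
      "total ?Z + left_reach (A \<union> ?Z) q' - \<delta> \<le> total (insert z ?Z)"
      using insert_left_of[OF Z qZ(2) \<open>0 < q'\<close> d] by metis
    moreover have "total (insert z ?Z) \<le> total (insert q (insert z ?Z))"
      using Z qZ z by (intro total_insert_shared) auto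
    ultimately show ?thesis
      using qZ q01 by (intro exI[of _ z] exI[of _ q]) auto
  qed
  then obtain y z where y: "y \<in> {0..1} - ?Z" "z \<in> {0..1} - ?Z" "y \<noteq> z"
    "?v - \<delta> \<le> total (insert z (insert y ?Z))"
    by blast
  have "card (X - {x} - {x'}) = card X - 2" "2 \<le> card X"
    using X(2) x card_mono[of X "{x, x'}"] by auto
  moreover have "X - {x} - {x'} = ?Z"
    by blast
  ultimately have "card (insert z (insert y ?Z)) = card X"
    using y Z by simp
  moreover have "finite (insert z (insert y ?Z))" "insert z (insert y ?Z) \<subseteq> {0..1}"
    using y Z by auto
  ultimately have "total (insert z (insert y ?Z)) \<le> total X"
    using X(1) unfolding best_response_def by blast
  then show "?v \<le> total X + \<delta>"
    using y(4) by simp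
qed

end

section \<open>Adjacent locations\<close>

definition consecutive :: "real set \<Rightarrow> real \<Rightarrow> real \<Rightarrow> bool" where
  "consecutive L a b \<longleftrightarrow> a \<in> L \<and> b \<in> L \<and> a < b \<and> {a<..<b} \<inter> L = {}"

lemma consecutive_reflect: "consecutive ((-) 1 ` L) (1 - b) (1 - a) \<longleftrightarrow> consecutive L a b"
proof -
  have "{1 - b<..<1 - a} \<inter> (-) 1 ` L = (-) 1 ` ({a<..<b} \<inter> L)"
    by auto
  moreover have "1 - p \<in> (-) 1 ` L \<longleftrightarrow> p \<in> L" for p
    by (auto simp: image_iff)
  ultimately show ?thesis
    unfolding consecutive_def by auto
qed

lemma consecutive_between: "consecutive L a b \<Longrightarrow> q \<in> L \<Longrightarrow> a < q \<Longrightarrow> b \<le> q"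
  "consecutive L a b \<Longrightarrow> q \<in> L \<Longrightarrow> q < b \<Longrightarrow> q \<le> a"
  unfolding consecutive_def by (meson disjoint_iff greaterThanLessThan_iff not_le_imp_less)+

text \<open>Used to read off the half cells of \<open>a\<close> and \<open>b\<close> after
  \<open>f\<close> between them has been withdrawn.\<close>

lemma consecutive_skip:
  assumes "consecutive L a f" "consecutive L f b" "L' \<subseteq> L" "f \<notin> L'" "a \<in> L'" "b \<in> L'"
  shows "consecutive L' a b"
proof -
  have "q \<notin> L'" if "a < q" "q < b" for q
  proof
    assume "q \<in> L'"
    then have "q \<in> L" "q \<noteq> f"
      using assms by auto
    then show False
      using consecutive_between(1)[OF assms(1), of q] consecutive_between(2)[OF assms(2), of q] that
      by simp
  qed
  then show ?thesis
    using assms unfolding consecutive_def by auto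
qed

lemma ex_consecutive_left:
  assumes "finite L" "p \<in> L" "\<exists>q\<in>L. q < p"
  obtains a where "consecutive L a p"
proof
  have "Max {q \<in> L. q < p} \<in> {q \<in> L. q < p}"
    using assms by (intro Max_in) auto
  moreover have "q \<le> Max {q \<in> L. q < p}" if "q \<in> L" "q < p" for q
    using that assms by simp
  ultimately show "consecutive L (Max {q \<in> L. q < p}) p"
    using assms(2) unfolding consecutive_def by fastforce
qed

lemma ex_consecutive_right:
  assumes "finite L" "p \<in> L" "\<exists>q\<in>L. p < q"
  obtains b where "consecutive L p b"
proof
  have "Min {q \<in> L. p < q} \<in> {q \<in> L. p < q}"
    using assms by (intro Min_in) auto
  moreover have "Min {q \<in> L. p < q} \<le> q" if "q \<in> L" "p < q" for q
    using that assms by simp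
  ultimately show "consecutive L p (Min {q \<in> L. p < q})"
    using assms(2) unfolding consecutive_def by fastforce
qed

lemma left_reach_consecutive:
  "finite L \<Longrightarrow> L \<subseteq> {0..1} \<Longrightarrow> consecutive L a p \<Longrightarrow> left_reach L p = (p - a) / 2"
  unfolding consecutive_def using left_reach_eq_gap by blast

lemma right_reach_consecutive:
  "finite L \<Longrightarrow> L \<subseteq> {0..1} \<Longrightarrow> consecutive L p b \<Longrightarrow> right_reach L p = (b - p) / 2"
  unfolding consecutive_def using right_reach_eq_gap by blast

lemma left_reach_pos: "finite L \<Longrightarrow> 0 < p \<Longrightarrow> 0 < left_reach L p"
  unfolding left_reach_def by (subst Min_gr_iff) auto

section \<open>Lone facilities in a best response\<close>

context opponents
begin

text \<open>Moving \<open>f\<close> just below \<open>b\<close> is profitable. If \<open>b\<close> is an own location too, both facilities move, to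
  either side of \<open>b\<close>; the next lemma uses the same deviation, and the one after it the analogous one
  at \<open>a\<close>.\<close>

lemma lone_endmost_not_best:
  assumes X: "best_response X" "finite X" "X \<subseteq> {0..1}" and f: "f \<in> X - A"
    and fb: "consecutive (A \<union> X) f b" "b \<in> A" and none: "\<not> (\<exists>q\<in>A \<union> X. q < f)"
  shows False
proof -
  let ?L = "A \<union> X"
  have L: "finite ?L" "?L \<subseteq> {0..1}" "f < b" "f \<noteq> b"
    using X A01 fb by (auto simp: consecutive_def)
  have sf: "share X f = f + (b - f) / 2"
    using f by (simp add: share_lone left_reach_eq_end[OF L(1) none]
        right_reach_consecutive[OF L(1,2) fb(1)])
  \<comment> \<open>Without \<open>f\<close>, the left half cell of \<open>b\<close> extends to the
    border and has length \<open>b\<close>, whereas \<open>f\<close> collected only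
    \<open>(f + b) / 2\<close>.\<close>
  have P: "left_reach (A \<union> Z) b = b" if "f \<notin> Z" "Z \<subseteq> X" for Z
  proof (rule left_reach_eq_end)
    show "finite (A \<union> Z)"
      using that X finite_subset by auto
    show "\<not> (\<exists>q\<in>A \<union> Z. q < b)"
    proof
      assume "\<exists>q\<in>A \<union> Z. q < b"
      then obtain q where q: "q \<in> A \<union> Z" "q < b"
        by blast
      then have "q \<le> f"
        using consecutive_between(2)[OF fb(1)] that by blast
      moreover have "\<not> q < f"
        using none q that by blast
      moreover have "q \<noteq> f"
        using q f that by blast
      ultimately show False
        by simp
    qed
  qed
  show False
  proof (cases "b \<in> X")
    case False
    have "total (X - {f}) + left_reach (A \<union> (X - {f})) b \<le> total X"
      using best_response_replace_left[OF X, of f b] f fb False by auto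
    moreover have "total X - share X f \<le> total (X - {f})"
      using total_remove_le[OF X(2), of "{f}"] f by simp
    moreover have "left_reach (A \<union> (X - {f})) b = b"
      by (rule P) auto
    ultimately show False
      using sf L(3) by argo
  next
    case True
    let ?Z = "X - {f, b}"
    have "total ?Z + right_reach (A \<union> ?Z) b + left_reach (A \<union> ?Z) b \<le> total X"
      using f fb True L by (intro best_response_replace_two[OF X]) auto
    moreover have "total X - (share X f + share X b) \<le> total ?Z"
      using total_remove_le[OF X(2), of "{f, b}"] f True L by simp
    moreover have "left_reach (A \<union> ?Z) b = b"
      by (rule P) auto
    moreover have "right_reach ?L b \<le> right_reach (A \<union> ?Z) b"
      by (rule right_reach_antimono[OF L(1)]) blast
    moreover have "0 \<le> right_reach ?L b"
      using right_reach_nonneg[OF L(1), of b] fb(2) A01 by auto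
    \<comment> \<open>As an opponent is at \<open>b\<close> too, the old facility there got at most
      half of its cell, whereas the two facilities on either side of \<open>b\<close> are credited
      with both halves in full.\<close>
    moreover have "share X b \<le> ((b - f) / 2 + right_reach ?L b) / 2"
    proof -
      have "left_reach ?L b = (b - f) / 2"
        by (rule left_reach_consecutive[OF L(1,2) fb(1)])
      then show ?thesis
        unfolding share_def using calculation(5) m_ge_1_of_mem[OF fb(2)] L
        by (intro frac_le) auto
    qed
    ultimately show False
      using sf L by argo
  qed
qed

lemma lone_pair_not_best:
  assumes X: "best_response X" "finite X" "X \<subseteq> {0..1}" and f: "f \<in> X - A" and a: "a \<in> X - A"
    and fb: "consecutive (A \<union> X) f b" "b \<in> A" and af: "consecutive (A \<union> X) a f"
  shows False
proof -
  let ?L = "A \<union> X"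
  have L: "finite ?L" "?L \<subseteq> {0..1}" "f < b" "f \<noteq> b" "a < f" "a \<noteq> f" "a \<noteq> b" "a < b"
    using X A01 fb af by (auto simp: consecutive_def)
  have sf: "share X f = (b - a) / 2"
    using f by (simp add: share_lone left_reach_consecutive[OF L(1,2) af]
        right_reach_consecutive[OF L(1,2) fb(1)] L field_simps)
  have ab: "consecutive (A \<union> Z) a b" if "f \<notin> Z" "Z \<subseteq> X" "a \<in> Z" for Z
    using that f fb af by (intro consecutive_skip[OF af fb(1)]) auto
  have Z01: "finite (A \<union> Z)" "A \<union> Z \<subseteq> {0..1}" if "Z \<subseteq> X" for Z
    using that X A01 finite_subset by auto
  \<comment> \<open>What \<open>f\<close> gives up by moving is just recovered at \<open>b\<close>,
    whose left half cell without \<open>f\<close> has length \<open>(b - a) / 2\<close>. The profit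
    comes from \<open>a\<close>, whose right half cell grows by \<open>(b - f) / 2\<close>.\<close>
  have extra: "(b - f) / 2 \<le> share Z a - share X a" if "f \<notin> Z" "Z \<subseteq> X" "a \<in> Z" for Z
  proof -
    have "left_reach ?L a \<le> left_reach (A \<union> Z) a"
      by (rule left_reach_antimono[OF L(1)]) (use that in blast)
    then show ?thesis
      using a right_reach_consecutive[OF Z01[OF that(2)] ab[OF that]]
        right_reach_consecutive[OF L(1,2) af]
      by (simp add: share_lone field_simps)
  qed
  show False
  proof (cases "b \<in> X")
    case False
    let ?Z = "X - {f}"
    have "total ?Z + left_reach (A \<union> ?Z) b \<le> total X"
      using best_response_replace_left[OF X, of f b] f fb False by auto
    moreover have "total X - share X f + (share ?Z a - share X a) \<le> total ?Z"
      using total_remove[OF X(2), of "{f}" a] f a L by simp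
    moreover have "left_reach (A \<union> ?Z) b = (b - a) / 2"
      using a L by (intro left_reach_consecutive Z01 ab) auto
    moreover have "(b - f) / 2 \<le> share ?Z a - share X a"
      using a L by (intro extra) auto
    ultimately show False
      using sf L by simp
  next
    case True
    let ?Z = "X - {f, b}"
    have "total ?Z + right_reach (A \<union> ?Z) b + left_reach (A \<union> ?Z) b \<le> total X"
      using f fb True L by (intro best_response_replace_two[OF X]) auto
    moreover have "total X - (share X f + share X b) + (share ?Z a - share X a) \<le> total ?Z"
      using total_remove[OF X(2), of "{f, b}" a] f a True L by simp
    moreover have "left_reach (A \<union> ?Z) b = (b - a) / 2"
      using a L by (intro left_reach_consecutive Z01 ab) auto
    moreover have "(b - f) / 2 \<le> share ?Z a - share X a"
      using a L by (intro extra) auto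
    moreover have "right_reach ?L b \<le> right_reach (A \<union> ?Z) b"
      by (rule right_reach_antimono[OF L(1)]) blast
    moreover have "0 \<le> right_reach ?L b"
      using right_reach_nonneg[OF L(1), of b] fb(2) A01 by auto
    moreover have "share X b \<le> ((b - f) / 2 + right_reach ?L b) / 2"
    proof -
      have "left_reach ?L b = (b - f) / 2"
        by (rule left_reach_consecutive[OF L(1,2) fb(1)])
      then show ?thesis
        unfolding share_def using calculation(6) m_ge_1_of_mem[OF fb(2)] L
        by (intro frac_le) auto
    qed
    ultimately show False
      using sf L by argo
  qed
qed

lemma lone_between_shared_not_best:
  assumes X: "best_response X" "finite X" "X \<subseteq> {0..1}" and f: "f \<in> X - A"
    and fb: "consecutive (A \<union> X) f b" "b \<in> A" "b \<in> X" and af: "consecutive (A \<union> X) a f" "a \<in> A"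
    and mult: "a \<in> X \<Longrightarrow> m b \<le> m a"
  shows False
proof -
  let ?L = "A \<union> X"
  have L: "finite ?L" "?L \<subseteq> {0..1}" "f < b" "f \<noteq> b" "a < f" "a \<noteq> f" "a \<noteq> b" "a < b"
    using X A01 fb af by (auto simp: consecutive_def)
  let ?x = "(f - a) / 2"
  have x: "0 < ?x"
    using L by simp
  have sf: "share X f = (b - a) / 2"
    using f by (simp add: share_lone left_reach_consecutive[OF L(1,2) af(1)]
        right_reach_consecutive[OF L(1,2) fb(1)] L field_simps)
  have ab: "consecutive (A \<union> Z) a b" if "f \<notin> Z" "Z \<subseteq> X" for Z
    using that f fb af by (intro consecutive_skip[OF af(1) fb(1)]) auto
  have Z01: "finite (A \<union> Z)" "A \<union> Z \<subseteq> {0..1}" if "Z \<subseteq> X" for Z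
    using that X A01 finite_subset by auto
  have D: "right_reach (A \<union> Z) a = (b - a) / 2" if "f \<notin> Z" "Z \<subseteq> X" for Z
    using that by (intro right_reach_consecutive Z01 ab) auto
  \<comment> \<open>Next to \<open>a\<close>, exactly the mass \<open>(b - a) / 2\<close> of
    \<open>f\<close> is recovered. The profit comes from \<open>b\<close>, whose left half cell
    grows by \<open>?x\<close>; the own facility there receives its part of this.\<close>
  have extra: "?x / (real (m b) + 1) \<le> share Z b - share X b" if "f \<notin> Z" "Z \<subseteq> X" for Z
  proof -
    have "right_reach ?L b \<le> right_reach (A \<union> Z) b"
      by (rule right_reach_antimono[OF L(1)]) (use that in blast)
    then have "?x \<le> left_reach (A \<union> Z) b + right_reach (A \<union> Z) b - (left_reach ?L b + right_reach ?L b)"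
      using left_reach_consecutive[OF Z01[OF that(2)] ab[OF that]]
        left_reach_consecutive[OF L(1,2) fb(1)]
      by (simp add: field_simps)
    then show ?thesis
      unfolding share_def diff_divide_distrib[symmetric] by (rule divide_right_mono) simp
  qed
  have pos: "0 < ?x / (real (m b) + 1)"
    using x by (intro divide_pos_pos) auto
  show False
  proof (cases "a \<in> X")
    case False
    let ?Z = "X - {f}"
    have "total ?Z + right_reach (A \<union> ?Z) a \<le> total X"
      using best_response_replace_right[OF X, of f a] f af False by auto
    moreover have "total X - share X f + (share ?Z b - share X b) \<le> total ?Z"
      using total_remove[OF X(2), of "{f}" b] f fb L by simp
    ultimately show False
      using sf D[of ?Z] extra[of ?Z] pos by auto
  next
    case True
    have xa: "right_reach ?L a = ?x"
      by (rule right_reach_consecutive[OF L(1,2) af(1)])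
    have ma: "1 \<le> real (m a)"
      by (rule m_ge_1_of_mem[OF af(2)])
    have half: "r / (real (m a) + 1) < r" if "0 < r" for r :: real
      using ma that by (simp add: field_simps)
    have sa: "share X a = left_reach ?L a / (real (m a) + 1) + ?x / (real (m a) + 1)"
      by (simp add: share_def xa add_divide_distrib)
    \<comment> \<open>If \<open>f\<close> and the facility at \<open>a\<close> move to either side
      of \<open>a\<close>, the strict profit is the part of the left half cell of \<open>a\<close>
      that opponents held, which requires \<open>0 < a\<close>. At \<open>a = 0\<close> it suffices
      to move the facility at \<open>a\<close> alone: it gets the whole right half cell.\<close>
    show False
    proof (cases "0 < a")
      case False
      have "left_reach ?L a = 0"
        using False left_reach_le(1)[OF L(1), of a] left_reach_nonneg[OF L(1), of a] af(2) A01 by force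
      then have "share X a = ?x / (real (m a) + 1)"
        using sa by simp
      moreover have "A \<union> (X - {a}) = ?L"
        using af by blast
      then have "total (X - {a}) + ?x \<le> total X"
        using best_response_replace_right[OF X True, of a] af xa by simp
      moreover have "total X - share X a \<le> total (X - {a})"
        using total_remove_le[OF X(2), of "{a}"] True by simp
      ultimately show False
        using half[OF x] by linarith
    next
      case a0: True
      let ?Z = "X - {f, a}"
      have "total ?Z + right_reach (A \<union> ?Z) a + left_reach (A \<union> ?Z) a \<le> total X"
        using f af True L by (intro best_response_replace_two[OF X]) auto
      moreover have "total X - (share X f + share X a) + (share ?Z b - share X b) \<le> total ?Z"
        using total_remove[OF X(2), of "{f, a}" b] f fb True L by auto
      moreover have "left_reach ?L a \<le> left_reach (A \<union> ?Z) a"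
        by (rule left_reach_antimono[OF L(1)]) blast
      moreover have "left_reach ?L a / (real (m a) + 1) < left_reach ?L a"
        by (rule half[OF left_reach_pos[OF L(1) a0]])
      \<comment> \<open>The part of the right half cell lost at \<open>a\<close> is covered by the
        gain at \<open>b\<close>, since \<open>b\<close> is shared with no more opponents than
        \<open>a\<close>.\<close>
      moreover have "?x / (real (m a) + 1) \<le> ?x / (real (m b) + 1)"
        using mult[OF True] x by (intro divide_left_mono) auto
      ultimately show False
        using sf sa D[of ?Z] extra[of ?Z] by auto
    qed
  qed
qed

text \<open>Between \<open>f'\<close> and the first opponent location \<open>b\<close> beyond it
  there are only lone own facilities. Hence the two locations just before \<open>b\<close>, here
  \<open>a\<close> and \<open>g\<close>, form a pair excluded by
  \<open>lone_pair_not_best\<close>.\<close>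

lemma lone_pair_left_of_opponent_not_best:
  assumes X: "best_response X" "finite X" "X \<subseteq> {0..1}" and f: "f \<in> X - A" "f' \<in> X - A"
    and ff: "consecutive (A \<union> X) f f'" and q: "q \<in> A" "f' < q"
  shows False
proof -
  let ?L = "A \<union> X"
  have L: "finite ?L"
    using X by simp
  define b where "b = Min {q \<in> A. f' < q}"
  have "b \<in> {q \<in> A. f' < q}"
    unfolding b_def using q by (intro Min_in) auto
  then have b: "b \<in> A" "f' < b"
    by auto
  have bmin: "b \<le> r" if "r \<in> A" "f' < r" for r
    unfolding b_def using that by (intro Min_le) auto
  obtain g where g: "consecutive ?L g b"
    using ex_consecutive_left[of ?L b] L b f by blast
  have g': "f' \<le> g" "g < b" "g \<in> ?L"
    using consecutive_between(2)[OF g, of f'] g b f by (auto simp: consecutive_def)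
  have "g \<notin> A"
    using bmin[of g] g' f by force
  have "f < g"
    using g' ff by (auto simp: consecutive_def)
  obtain a where a: "consecutive ?L a g"
    using ex_consecutive_left[of ?L g] L g'(3) f \<open>f < g\<close> by blast
  have a': "f \<le> a" "a < g" "a \<in> ?L"
    using consecutive_between(2)[OF a, of f] a f \<open>f < g\<close> by (auto simp: consecutive_def)
  have "a \<notin> A"
  proof
    assume "a \<in> A"
    then have "f < a" "a \<noteq> f'"
      using a' f by (auto simp: less_le)
    then have "f' < a"
      using consecutive_between(1)[OF ff a'(3)] by simp
    then show False
      using bmin[OF \<open>a \<in> A\<close>] a' g' by simp
  qed
  then show False
    using lone_pair_not_best[OF X _ _ g b(1) a] \<open>g \<notin> A\<close> g' a' by blast
qed

text \<open>If \<open>b\<close> is lone, some opponent is right of \<open>b\<close> or left of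
  \<open>f\<close>, and the previous lemma or its mirror image applies. If \<open>b\<close> is
  shared, the location before \<open>f\<close> decides: it may be missing, lone or an opponent's. In
  the last case, when both neighbors are own as well, comparing \<open>m a\<close> with
  \<open>m b\<close> tells whether \<open>lone_between_shared_not_best\<close> is used directly or
  reflected.\<close>

lemma lone_right_neighbor_not_own:
  assumes X: "best_response X" "finite X" "X \<subseteq> {0..1}" and f: "f \<in> X - A"
    and fb: "consecutive (A \<union> X) f b"
  shows "b \<notin> X"
proof
  assume b: "b \<in> X"
  let ?L = "A \<union> X"
  have L: "finite ?L" "f \<in> ?L"
    using X f by auto
  interpret r: opponents "(-) 1 ` A" "\<lambda>p. m (1 - p)"
    by (rule reflect)
  let ?X = "(-) 1 ` X"
  have X': "r.best_response ?X" "finite ?X" "?X \<subseteq> {0..1}"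
    using X best_response_reflect by auto
  have in_reflect: "1 - p \<in> (-) 1 ` B \<longleftrightarrow> p \<in> B" for p and B :: "real set"
    by (auto simp: image_iff)
  have con: "consecutive ((-) 1 ` A \<union> ?X) (1 - q) (1 - p) \<longleftrightarrow> consecutive ?L p q" for p q
    by (simp add: image_Un[symmetric] consecutive_reflect)
  show False
  proof (cases "b \<in> A")
    case False
    show False
    proof (cases "\<exists>q\<in>A. b < q")
      case True
      then show False
        using lone_pair_left_of_opponent_not_best[OF X f _ fb] b False by blast
    next
      case no: False
      obtain q where q: "q \<in> A"
        using A_nonempty by blast
      then have "q \<le> b" "q \<noteq> b" "q \<noteq> f"
        using no f False by auto
      then have "q < f"
        using consecutive_between(1)[OF fb, of q] q by force
      then show False
        using r.lone_pair_left_of_opponent_not_best[OF X', of "1 - b" "1 - f" "1 - q"] b f q False fb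
        by (simp add: in_reflect con)
    qed
  next
    case True
    show False
    proof (cases "\<exists>q\<in>?L. q < f")
      case False
      then show False
        using lone_endmost_not_best[OF X f fb True] by blast
    next
      case True': True
      obtain a where a: "consecutive ?L a f"
        using ex_consecutive_left[OF L True'] .
      then have "a \<in> ?L"
        by (simp add: consecutive_def)
      show False
      proof (cases "a \<in> A")
        case False
        then show False
          using lone_pair_not_best[OF X f _ fb True a] \<open>a \<in> ?L\<close> by blast
      next
        case aA: True
        show False
        proof (cases "a \<in> X \<longrightarrow> m b \<le> m a")
          case le: True
          then show False
            using lone_between_shared_not_best[OF X f fb True b a aA] by blast
        next
          case False
          then show False
            using r.lone_between_shared_not_best[OF X', of "1 - f" "1 - a" "1 - b"] f fb a aA b True
            by (simp add: in_reflect con)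
        qed
      qed
    qed
  qed
qed

lemma lone_left_neighbor_not_own:
  assumes X: "best_response X" "finite X" "X \<subseteq> {0..1}" and f: "f \<in> X - A"
    and af: "consecutive (A \<union> X) a f"
  shows "a \<notin> X"
proof -
  interpret r: opponents "(-) 1 ` A" "\<lambda>p. m (1 - p)"
    by (rule reflect)
  have "1 - a \<notin> (-) 1 ` X"
  proof (rule r.lone_right_neighbor_not_own)
    show "r.best_response ((-) 1 ` X)"
      by (rule best_response_reflect[OF X(1)])
    show "consecutive ((-) 1 ` A \<union> (-) 1 ` X) (1 - f) (1 - a)"
      using af by (simp add: image_Un[symmetric] consecutive_reflect)
  qed (use X f in auto)
  then show ?thesis
    by blast
qed

text \<open>As opponents exist, a leftmost \<open>f\<close> has a neighbor on the right. It is not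
  own, hence an opponent's, and \<open>lone_endmost_not_best\<close> applies.\<close>

lemma lone_has_left:
  assumes X: "best_response X" "finite X" "X \<subseteq> {0..1}" and f: "f \<in> X - A"
  shows "\<exists>a\<in>A \<union> X. a < f"
proof (rule ccontr)
  assume none: "\<not> (\<exists>a\<in>A \<union> X. a < f)"
  obtain q where "q \<in> A"
    using A_nonempty by blast
  then have "f < q"
    using none f by (metis DiffD2 UnI1 linorder_neqE)
  then have "\<exists>b\<in>A \<union> X. f < b"
    using \<open>q \<in> A\<close> by blast
  then obtain b where b: "consecutive (A \<union> X) f b"
    using ex_consecutive_right[of "A \<union> X" f] X f by auto
  have "b \<in> A"
    using lone_right_neighbor_not_own[OF X f b] b by (auto simp: consecutive_def)
  then show False
    using lone_endmost_not_best[OF X f b] none by blast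
qed

lemma lone_has_right:
  assumes X: "best_response X" "finite X" "X \<subseteq> {0..1}" and f: "f \<in> X - A"
  shows "\<exists>b\<in>A \<union> X. f < b"
proof -
  interpret r: opponents "(-) 1 ` A" "\<lambda>p. m (1 - p)"
    by (rule reflect)
  have "\<exists>a\<in>(-) 1 ` A \<union> (-) 1 ` X. a < 1 - f"
  proof (rule r.lone_has_left)
    show "r.best_response ((-) 1 ` X)"
      by (rule best_response_reflect[OF X(1)])
  qed (use X f in auto)
  then show ?thesis
    by auto
qed

section \<open>Equal masses and bounds on half cells\<close>

lemma share_between:
  assumes X: "finite X" "X \<subseteq> {0..1}" and f: "f \<notin> A"
    and c: "consecutive (A \<union> X) a f" "consecutive (A \<union> X) f b"
  shows "share X f = (b - a) / 2"
proof -
  have L: "finite (A \<union> X)" "A \<union> X \<subseteq> {0..1}"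
    using X A01 by auto
  show ?thesis
    using left_reach_consecutive[OF L c(1)] right_reach_consecutive[OF L c(2)] share_lone[OF f, of X]
    by (simp add: field_simps)
qed

text \<open>Moving \<open>f\<close> and \<open>f'\<close> together can bring twice the mass of
  \<open>f'\<close>, up to an arbitrarily small loss, so \<open>f\<close> cannot have had less. If
  \<open>f'\<close> is shared, the two halves of its cell suffice, as it got at most half of their
  sum. If it is lone, both neighbors are opponents', and the half cells facing each other across the
  gap left by \<open>f'\<close> have length \<open>(b - a) / 2\<close> each.\<close>

lemma best_response_share_le:
  assumes X: "best_response X" "finite X" "X \<subseteq> {0..1}" and f: "f \<in> X" "f' \<in> X"
  shows "share X f' \<le> share X f"
proof (cases "f = f'")
  case neq: False
  let ?L = "A \<union> X" and ?Z = "X - {f, f'}"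
  have L: "finite ?L" "f' \<in> ?L" "finite (A \<union> ?Z)"
    using X f by auto
  have rem: "total X - (share X f + share X f') \<le> total ?Z"
    using total_remove_le[OF X(2), of "{f, f'}"] f neq by simp
  show ?thesis
  proof (cases "f' \<in> A")
    case True
    have "total ?Z + right_reach (A \<union> ?Z) f' + left_reach (A \<union> ?Z) f' \<le> total X"
      using f neq True by (intro best_response_replace_two[OF X]) auto
    moreover have "right_reach ?L f' \<le> right_reach (A \<union> ?Z) f'"
      "left_reach ?L f' \<le> left_reach (A \<union> ?Z) f'"
      by (rule right_reach_antimono[OF L(1)] left_reach_antimono[OF L(1)], blast)+
    moreover have "2 * share X f' \<le> (real (m f') + 1) * share X f'"
      using share_nonneg[OF X(2), of f'] m_ge_1_of_mem[OF True] f X by (intro mult_right_mono) auto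
    then have "2 * share X f' \<le> left_reach ?L f' + right_reach ?L f'"
      by (simp add: share_def)
    ultimately show ?thesis
      using rem by simp
  next
    case False
    then have f': "f' \<in> X - A"
      using f by blast
    obtain a b where ab: "consecutive ?L a f'" "consecutive ?L f' b"
      using ex_consecutive_left[OF L(1,2)] ex_consecutive_right[OF L(1,2)]
        lone_has_left[OF X f'] lone_has_right[OF X f'] by metis
    have own: "a \<notin> X" "b \<notin> X"
      using lone_left_neighbor_not_own[OF X f' ab(1)] lone_right_neighbor_not_own[OF X f' ab(2)] by auto
    then have A: "a \<in> A" "b \<in> A" "a < f'" "f' < b" "a \<le> b" "0 \<le> a" "b \<le> 1"
      using ab A01 by (auto simp: consecutive_def)
    have out: "q \<le> a \<or> b \<le> q" if "q \<in> A \<union> ?Z" for q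
    proof -
      have "q \<in> ?L" "q \<noteq> f'"
        using that False by auto
      then show ?thesis
        using consecutive_between(2)[OF ab(1), of q] consecutive_between(1)[OF ab(2), of q] by force
    qed
    have "total ?Z + right_reach (A \<union> ?Z) a + left_reach (A \<union> ?Z) b \<le> total X"
      using f neq A own by (intro best_response_replace_two[OF X]) auto
    moreover have "(b - a) / 2 \<le> right_reach (A \<union> ?Z) a"
      using A out L(3) by (subst le_right_reach_iff) force+
    moreover have "(b - a) / 2 \<le> left_reach (A \<union> ?Z) b"
      using A out L(3) by (subst le_left_reach_iff) force+
    moreover have "share X f' = (b - a) / 2"
      by (rule share_between[OF X(2,3) False ab])
    ultimately show ?thesis
      using rem by simp
  qed
qed simp

text \<open>Entering one half of the cell of an opponent's location must not bring more than the
  facility given up for it. At a lone location the half cell is part of the share.\<close>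

lemma best_response_reach_le:
  assumes X: "best_response X" "finite X" "X \<subseteq> {0..1}" and x: "x \<in> X" and q: "q \<in> A \<union> X"
  shows "left_reach (A \<union> X) q \<le> share X x \<and> right_reach (A \<union> X) q \<le> share X x"
proof -
  let ?L = "A \<union> X"
  have L: "finite ?L"
    using X by simp
  \<comment> \<open>If an own facility is at \<open>q\<close>, it has to be the one that moves; the
    comparison of shares then carries the bound over to \<open>x\<close>.\<close>
  define x' where "x' = (if q \<in> X then q else x)"
  have x': "x' \<in> X" "q \<notin> X - {x'}"
    using x by (auto simp: x'_def)
  have le: "share X x' \<le> share X x"
    by (rule best_response_share_le[OF X x x'(1)])
  show ?thesis
  proof (cases "q \<in> A")
    case True
    have "total (X - {x'}) + left_reach (A \<union> (X - {x'})) q \<le> total X"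
      "total (X - {x'}) + right_reach (A \<union> (X - {x'})) q \<le> total X"
      using best_response_replace_left[OF X x'(1) True x'(2)]
        best_response_replace_right[OF X x'(1) True x'(2)] .
    moreover have "left_reach ?L q \<le> left_reach (A \<union> (X - {x'})) q"
      "right_reach ?L q \<le> right_reach (A \<union> (X - {x'})) q"
      by (rule right_reach_antimono[OF L] left_reach_antimono[OF L], blast)+
    moreover have "total X - share X x' \<le> total (X - {x'})"
      using total_remove_le[OF X(2), of "{x'}"] x' by simp
    ultimately show ?thesis
      using le by simp
  next
    case False
    then have "q = x'" "0 \<le> q" "q \<le> 1"
      using q X by (auto simp: x'_def)
    then show ?thesis
      using share_lone[OF False, of X] le left_reach_nonneg[OF L, of q] right_reach_nonneg[OF L, of q]
      by simp
  qed
qed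

text \<open>The first two conjuncts are the player's part of conditions 1 and 2 of the theorem. The
  other two, taken over all players, become \<open>balanced\<close> below, which stands for
  condition 3.\<close>

definition stable :: "real set \<Rightarrow> bool" where
  "stable X \<longleftrightarrow>
     (\<forall>f\<in>X - A. \<forall>f'\<in>X. \<not> consecutive (A \<union> X) f f' \<and> \<not> consecutive (A \<union> X) f' f) \<and>
     (\<forall>f\<in>X. \<forall>f'\<in>X. share X f = share X f') \<and>
     (\<forall>x\<in>X. \<forall>q\<in>A \<union> X. left_reach (A \<union> X) q \<le> share X x \<and> right_reach (A \<union> X) q \<le> share X x) \<and>
     (\<forall>f\<in>X - A. (\<exists>a\<in>A \<union> X. a < f) \<and> (\<exists>b\<in>A \<union> X. f < b))"

lemma best_response_imp_stable:
  assumes X: "best_response X" "finite X" "X \<subseteq> {0..1}"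
  shows "stable X"
  unfolding stable_def
  using lone_right_neighbor_not_own[OF X] lone_left_neighbor_not_own[OF X]
    lone_has_left[OF X] lone_has_right[OF X] best_response_share_le[OF X] best_response_reach_le[OF X]
  by (meson antisym)

text \<open>Withdrawing all of \<open>X\<close> changes the half cell of \<open>q\<close> on one
  side only if the adjacent facility \<open>b\<close> there is lone. Stability provides a further
  location \<open>c\<close> beyond \<open>b\<close>, which is an opponent's. So the half cell is at
  most half the distance from \<open>q\<close> to \<open>c\<close>, and this is the mass of
  \<open>b\<close>.\<close>

lemma stable_reach_others_le:
  assumes st: "stable X" and X: "finite X" "X \<subseteq> {0..1}" and x: "x \<in> X" and q: "q \<in> A"
  shows "left_reach A q \<le> share X x" and "right_reach A q \<le> share X x"
proof -
  let ?L = "A \<union> X"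
  have L: "finite ?L" "q \<in> ?L" "?L \<subseteq> {0..1}"
    using X q A01 by auto
  have reach: "left_reach ?L q \<le> share X x" "right_reach ?L q \<le> share X x"
    using st x L(2) unfolding stable_def by blast+
  have lone: "share X f = share X x" "\<exists>a\<in>?L. a < f" "\<exists>b\<in>?L. f < b"
    "\<And>g. g \<in> X \<Longrightarrow> \<not> consecutive ?L f g \<and> \<not> consecutive ?L g f" if "f \<in> X - A" for f
    using st x that unfolding stable_def by blast+
  show "right_reach A q \<le> share X x"
  proof (cases "\<exists>b\<in>?L. q < b")
    case True
    obtain b where b: "consecutive ?L q b"
      using ex_consecutive_right[OF L(1,2) True] .
    show ?thesis
    proof (cases "b \<in> A")
      case True
      then show ?thesis
        using right_reach_le(2)[OF finite_A True, of q] right_reach_consecutive[OF L(1,3) b] reach b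
        by (simp add: consecutive_def)
    next
      case False
      then have b': "b \<in> X - A" "b \<in> ?L"
        using b by (auto simp: consecutive_def)
      obtain c where c: "consecutive ?L b c"
        using ex_consecutive_right[OF L(1) b'(2) lone(3)[OF b'(1)]] .
      then have "c \<in> A" "q < c"
        using lone(4)[OF b'(1)] b by (auto simp: consecutive_def)
      then show ?thesis
        using right_reach_le(2)[OF finite_A, of c q] share_between[OF X False b c] lone(1)[OF b'(1)]
        by simp
    qed
  next
    case False
    then show ?thesis
      using right_reach_eq_end[OF L(1) False] right_reach_le(1)[OF finite_A, of q] reach by simp
  qed
  show "left_reach A q \<le> share X x"
  proof (cases "\<exists>b\<in>?L. b < q")
    case True
    obtain b where b: "consecutive ?L b q"
      using ex_consecutive_left[OF L(1,2) True] .
    show ?thesis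
    proof (cases "b \<in> A")
      case True
      then show ?thesis
        using left_reach_le(2)[OF finite_A True, of q] left_reach_consecutive[OF L(1,3) b] reach b
        by (simp add: consecutive_def)
    next
      case False
      then have b': "b \<in> X - A" "b \<in> ?L"
        using b by (auto simp: consecutive_def)
      obtain c where c: "consecutive ?L c b"
        using ex_consecutive_left[OF L(1) b'(2) lone(2)[OF b'(1)]] .
      then have "c \<in> A" "c < q"
        using lone(4)[OF b'(1)] b by (auto simp: consecutive_def)
      then show ?thesis
        using left_reach_le(2)[OF finite_A, of c q] share_between[OF X False c b] lone(1)[OF b'(1)]
        by simp
    qed
  next
    case False
    then show ?thesis
      using left_reach_eq_end[OF L(1) False] left_reach_le(1)[OF finite_A, of q] reach by simp
  qed
qed

text \<open>Own facilities only cut down each other's cells, so the rest of \<open>Y\<close> may be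
  dropped. At an opponent's location two half cells are divided by at least 2. Elsewhere the whole
  cell of \<open>p\<close> is no longer than one half cell of an adjacent opponent's location: the
  right one of \<open>a\<close> before \<open>p\<close> or, if there is none, the left one of the
  first location \<open>b\<close>.\<close>

lemma stable_share_le:
  assumes st: "stable X" and X: "finite X" "X \<subseteq> {0..1}" and x: "x \<in> X"
    and Y: "finite Y" and p: "p \<in> {0..1}"
  shows "share Y p \<le> share X x"
proof -
  let ?v = "share X x"
  note reach = stable_reach_others_le[OF st X x]
  have "share Y p \<le> share {} p"
    by (rule share_antimono[OF Y]) blast
  also have "\<dots> \<le> ?v"
  proof (cases "p \<in> A")
    case True
    have "left_reach A p + right_reach A p \<le> 2 * ?v"
      using reach[OF True] by simp
    also have "\<dots> \<le> (real (m p) + 1) * ?v"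
      using m_ge_1_of_mem[OF True] share_nonneg[OF X(1), of x] x X by (intro mult_right_mono) auto
    finally show ?thesis
      by (simp add: share_def field_simps)
  next
    case False
    have "left_reach A p + right_reach A p \<le> ?v"
    proof (cases "\<exists>q\<in>A. q < p")
      case True
      obtain a where "consecutive (insert p A) a p"
        using ex_consecutive_left[of "insert p A" p] True by auto
      note ap = this
      have a: "a \<in> A" "a < p"
        using ap by (auto simp: consecutive_def)
      have gap: "p < q" if "q \<in> A" "a < q" for q
        using consecutive_between(1)[OF ap, of q] that False by (cases "q = p") auto
      have "left_reach A p + right_reach A p \<le> right_reach A a"
        unfolding le_right_reach_iff[OF finite_A]
      proof (intro conjI ballI impI)
        show "left_reach A p + right_reach A p \<le> 1 - a"
          using left_reach_le(2)[OF finite_A a(1,2)] right_reach_le(1)[OF finite_A, of p] a(2) by simp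
        show "left_reach A p + right_reach A p \<le> (q - a) / 2" if "q \<in> A" "a < q" for q
          using left_reach_le(2)[OF finite_A a(1,2)] right_reach_le(2)[OF finite_A that(1) gap[OF that]]
          by (simp add: field_simps)
      qed
      then show ?thesis
        using reach(2)[OF a(1)] by simp
    next
      case none: False
      define b where "b = Min A"
      have b: "b \<in> A" "\<And>q. q \<in> A \<Longrightarrow> b \<le> q"
        using A_nonempty by (auto simp: b_def)
      then have "p < b"
        using none False by (cases p b rule: linorder_cases) auto
      have "\<not> (\<exists>q\<in>A. q < b)"
        using b(2) by (simp add: not_less)
      then have "left_reach A b = b"
        by (intro left_reach_eq_end) simp_all
      then show ?thesis
        using left_reach_le(1)[OF finite_A, of p] right_reach_le(2)[OF finite_A b(1) \<open>p < b\<close>] reach(1)[OF b(1)]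
          \<open>p < b\<close> by simp
    qed
    then show ?thesis
      using share_lone[OF False, of "{}"] by simp
  qed
  finally show ?thesis .
qed

text \<open>A stable \<open>X\<close> collects \<open>card X\<close> times the common share, and
  none of the equally many facilities of a deviation collects more than this share.\<close>

theorem best_response_iff_stable:
  assumes X: "finite X" "X \<subseteq> {0..1}"
  shows "best_response X \<longleftrightarrow> stable X"
proof
  assume st: "stable X"
  show "best_response X"
    unfolding best_response_def
  proof (intro allI impI)
    fix Y :: "real set"
    assume Y: "finite Y \<and> Y \<subseteq> {0..1} \<and> card Y = card X"
    show "total Y \<le> total X"
    proof (cases "X = {}")
      case True
      then have "Y = {}"
        using Y by auto
      then show ?thesis
        using True by simp
    next
      case False
      then obtain x where x: "x \<in> X"
        by blast
      have "total Y \<le> (\<Sum>p\<in>Y. share X x)"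
        unfolding total_def using Y by (intro sum_mono stable_share_le[OF st X x]) auto
      also have "\<dots> = (\<Sum>p\<in>X. share X x)"
        using Y by simp
      also have "\<dots> = total X"
        unfolding total_def using st x unfolding stable_def by (intro sum.cong refl) blast
      finally show ?thesis .
    qed
  qed
qed (rule best_response_imp_stable[OF _ X])

end

section \<open>Equilibria and flattening\<close>

definition others :: "nat \<Rightarrow> (nat \<Rightarrow> real list) \<Rightarrow> nat \<Rightarrow> real set" where
  "others N s i = (\<Union>j\<in>{1..N} - {i}. set (s j))"

definition other_owners :: "nat \<Rightarrow> (nat \<Rightarrow> real list) \<Rightarrow> nat \<Rightarrow> real \<Rightarrow> nat" where
  "other_owners N s i p = card {j \<in> {1..N} - {i}. p \<in> set (s j)}"

lemma locations_eq_others_Un: "i \<in> {1..N} \<Longrightarrow> locations N s = others N s i \<union> set (s i)"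
  by (auto simp: locations_def others_def)

lemma others_update: "others N (s(i := x)) i = others N s i"
  by (auto simp: others_def)

lemma other_owners_update: "other_owners N (s(i := x)) i = other_owners N s i"
  unfolding other_owners_def fun_eq_iff by (intro allI arg_cong[where f = card]) auto

lemma card_owners_own:
  assumes "i \<in> {1..N}" "p \<in> set (s i)"
  shows "card (owners N s p) = Suc (other_owners N s i p)"
proof -
  have "owners N s p = insert i {j \<in> {1..N} - {i}. p \<in> set (s j)}"
    using assms by (auto simp: owners_def)
  then show ?thesis
    by (simp add: other_owners_def)
qed

lemma lone_iff: "lone N s i f \<longleftrightarrow> f \<in> set (s i) - others N s i"
  by (auto simp: lone_def others_def)

lemma neighbors_iff_consecutive:
  "neighbors N s f f' \<longleftrightarrow> consecutive (locations N s) f f' \<or> consecutive (locations N s) f' f"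
  by (cases f f' rule: linorder_cases) (auto simp: neighbors_def consecutive_def)

lemma strategies_nonempty: "x \<in> strategies k \<Longrightarrow> 0 < k \<Longrightarrow> x \<noteq> []"
  by (auto simp: strategies_def)

lemma card_set_strategies: "x \<in> strategies k \<Longrightarrow> card (set x) = k"
  by (auto simp: strategies_def strict_sorted_iff distinct_card)

lemma ex_strategies:
  assumes "finite Y" "Y \<subseteq> {0..1}"
  obtains x where "x \<in> strategies (card Y)" "set x = Y"
  using that[of "sorted_list_of_set Y"] assms by (simp add: strategies_def)

text \<open>Interpreted twice in the end, for the given profile and for the flattened one. With two
  players everyone faces an opponent, as the locale \<open>opponents\<close> demands.\<close>

locale profile =
  fixes N :: nat and n :: "nat \<Rightarrow> nat" and s :: "nat \<Rightarrow> real list"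
  assumes two_players: "2 \<le> N" and sizes_pos: "\<And>i. i \<in> {1..N} \<Longrightarrow> 0 < n i"
    and profile: "pure_profile N n s"
begin

lemma strategy: "i \<in> {1..N} \<Longrightarrow> s i \<in> strategies (n i)"
  using profile by (simp add: pure_profile_def)

lemma strategy_nonempty: "i \<in> {1..N} \<Longrightarrow> s i \<noteq> []"
  using strategy strategies_nonempty sizes_pos by blast

lemma strategy01: "i \<in> {1..N} \<Longrightarrow> set (s i) \<subseteq> {0..1}"
  using strategy by (auto simp: strategies_def)

lemma locations01: "locations N s \<subseteq> {0..1}"
  unfolding locations_def by (rule UN_least) (rule strategy01)

lemma mass_eq: "p \<in> locations N s \<Longrightarrow> facility_mass N s p =
    (left_reach (locations N s) p + right_reach (locations N s) p) / real (card (owners N s p))"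
  by (rule facility_mass_eq[OF strategy_nonempty _ locations01])

lemma opponents: "opponents (others N s i) (other_owners N s i)"
proof
  show "others N s i \<subseteq> {0..1}"
    unfolding others_def by (rule UN_least) (use strategy01 in blast)
  have "(if i = 1 then 2 else 1) \<in> {1..N} - {i}"
    using two_players by auto
  then obtain j where j: "j \<in> {1..N} - {i}"
    by blast
  then have "set (s j) \<subseteq> others N s i" "s j \<noteq> []"
    using strategy_nonempty by (auto simp: others_def)
  then show "others N s i \<noteq> {}"
    by auto
  show "0 < other_owners N s i p \<longleftrightarrow> p \<in> others N s i" for p
    by (auto simp: other_owners_def others_def card_gt_0_iff)
qed (simp add: others_def)

lemma share_eq_mass:
  assumes i: "i \<in> {1..N}" and p: "p \<in> set (s i)"
  shows "opponents.share (others N s i) (other_owners N s i) (set (s i)) p = facility_mass N s p"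
proof -
  interpret opponents "others N s i" "other_owners N s i"
    by (rule opponents)
  have "p \<in> locations N s"
    using i p by (auto simp: locations_def)
  then show ?thesis
    by (simp add: share_def mass_eq card_owners_own[where s = s, OF i p] locations_eq_others_Un[OF i, symmetric] add.commute)
qed

lemma total_eq_payoff:
  assumes i: "i \<in> {1..N}"
  shows "opponents.total (others N s i) (other_owners N s i) (set (s i)) = payoff N s i"
proof -
  interpret opponents "others N s i" "other_owners N s i"
    by (rule opponents)
  have "total (set (s i)) = (\<Sum>p\<in>set (s i). facility_mass N s p)"
    unfolding total_def by (intro sum.cong refl share_eq_mass[OF i])
  also have "\<dots> = payoff N s i"
    by (rule payoff_eq_sum_mass[OF strategy_nonempty locations01 i, symmetric])
  finally show ?thesis .
qed

lemma profile_update: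
  assumes "i \<in> {1..N}" "x \<in> strategies (n i)"
  shows "profile N n (s(i := x))"
  using profile two_players sizes_pos assms by unfold_locales (auto simp: pure_profile_def)

text \<open>A deviation of player \<open>i\<close> changes neither \<open>others\<close> nor
  \<open>other_owners\<close>, so all payoffs that she compares are values of \<open>total\<close>
  in one instance of \<open>opponents\<close>. Sorting turns the finite sets considered there into
  strategies.\<close>

lemma nash_iff_best_response:
  "pure_nash N n s \<longleftrightarrow>
     (\<forall>i\<in>{1..N}. opponents.best_response (others N s i) (other_owners N s i) (set (s i)))"
proof -
  have "(\<forall>x\<in>strategies (n i). \<not> payoff N (s(i := x)) i > payoff N s i) \<longleftrightarrow>
      opponents.best_response (others N s i) (other_owners N s i) (set (s i))" if i: "i \<in> {1..N}" for i
  proof -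
    interpret opponents "others N s i" "other_owners N s i"
      by (rule opponents)
    have dev: "payoff N (s(i := x)) i = total (set x)" if "x \<in> strategies (n i)" for x
      using profile.total_eq_payoff[OF profile_update[OF i that] i]
      by (simp add: others_update other_owners_update)
    have own: "payoff N s i = total (set (s i))"
      by (rule total_eq_payoff[OF i, symmetric])
    have card: "card (set (s i)) = n i"
      by (rule card_set_strategies[OF strategy[OF i]])
    show ?thesis
    proof
      assume nash: "\<forall>x\<in>strategies (n i). \<not> payoff N (s(i := x)) i > payoff N s i"
      show "best_response (set (s i))"
        unfolding best_response_def
      proof (intro allI impI)
        fix Y :: "real set"
        assume Y: "finite Y \<and> Y \<subseteq> {0..1} \<and> card Y = card (set (s i))"
        then obtain x where "x \<in> strategies (n i)" "set x = Y"
          using ex_strategies[of Y] card by metis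
        then show "total Y \<le> total (set (s i))"
          using nash dev own by (metis not_less)
      qed
    next
      assume br: "best_response (set (s i))"
      show "\<forall>x\<in>strategies (n i). \<not> payoff N (s(i := x)) i > payoff N s i"
      proof
        fix x assume x: "x \<in> strategies (n i)"
        then have "finite (set x) \<and> set x \<subseteq> {0..1} \<and> card (set x) = card (set (s i))"
          using card_set_strategies[OF x] card by (simp add: strategies_def)
        then have "total (set x) \<le> total (set (s i))"
          using br unfolding best_response_def by blast
        then show "\<not> payoff N (s(i := x)) i > payoff N s i"
          using dev[OF x] own by simp
      qed
    qed
  qed
  then show ?thesis
    unfolding pure_nash_def using profile by blast
qed

text \<open>A condition without reference to players: one owner means that \<open>p\<close> is lone,
  and by \<open>mass_eq\<close> the masses depend only on the locations and the numbers of owners.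
  This makes it invariant under flattening.\<close>

definition balanced :: bool where
  "balanced \<longleftrightarrow>
     (\<forall>p\<in>locations N s. \<forall>q\<in>locations N s.
        left_reach (locations N s) q \<le> facility_mass N s p \<and>
        right_reach (locations N s) q \<le> facility_mass N s p) \<and>
     (\<forall>p\<in>locations N s. card (owners N s p) = 1 \<longrightarrow>
        (\<exists>a\<in>locations N s. a < p) \<and> (\<exists>b\<in>locations N s. p < b))"

text \<open>For each player, \<open>P1\<close> to \<open>P4\<close> are the conjuncts of
  \<open>stable\<close>. As every location has an owner, \<open>P3\<close> and \<open>P4\<close> for
  all players amount to \<open>balanced\<close>.\<close>

lemma nash_iff_balanced:
  "pure_nash N n s \<longleftrightarrow>
      \<not> (\<exists>i\<in>{1..N}. \<exists>f\<in>set (s i). \<exists>f'\<in>set (s i). lone N s i f \<and> neighbors N s f f')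
    \<and> (\<forall>i\<in>{1..N}. \<forall>f\<in>set (s i). \<forall>f'\<in>set (s i). facility_mass N s f = facility_mass N s f')
    \<and> balanced"
proof -
  let ?L = "locations N s"
  define P1 where "P1 i \<longleftrightarrow> (\<forall>f\<in>set (s i). \<forall>f'\<in>set (s i). \<not> (lone N s i f \<and> neighbors N s f f'))" for i
  define P2 where "P2 i \<longleftrightarrow> (\<forall>f\<in>set (s i). \<forall>f'\<in>set (s i). facility_mass N s f = facility_mass N s f')" for i
  define P3 where "P3 i \<longleftrightarrow> (\<forall>p\<in>set (s i). \<forall>q\<in>?L. left_reach ?L q \<le> facility_mass N s p
      \<and> right_reach ?L q \<le> facility_mass N s p)" for i
  define P4 where "P4 i \<longleftrightarrow> (\<forall>p\<in>set (s i). card (owners N s p) = 1 \<longrightarrow>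
      (\<exists>a\<in>?L. a < p) \<and> (\<exists>b\<in>?L. p < b))" for i
  have "opponents.best_response (others N s i) (other_owners N s i) (set (s i)) \<longleftrightarrow>
      P1 i \<and> P2 i \<and> P3 i \<and> P4 i" if i: "i \<in> {1..N}" for i
  proof -
    interpret opponents "others N s i" "other_owners N s i"
      by (rule opponents)
    let ?X = "set (s i)"
    have "best_response ?X \<longleftrightarrow> stable ?X"
      using strategy01[OF i] by (intro best_response_iff_stable) auto
    moreover have "P1 i \<longleftrightarrow> (\<forall>f\<in>?X - others N s i. \<forall>f'\<in>?X.
        \<not> consecutive ?L f f' \<and> \<not> consecutive ?L f' f)"
      unfolding P1_def lone_iff neighbors_iff_consecutive by blast
    moreover have "P2 i \<longleftrightarrow> (\<forall>f\<in>?X. \<forall>f'\<in>?X. share ?X f = share ?X f')"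
      unfolding P2_def by (intro ball_cong refl) (simp add: share_eq_mass[OF i])
    moreover have "P3 i \<longleftrightarrow> (\<forall>p\<in>?X. \<forall>q\<in>?L. left_reach ?L q \<le> share ?X p \<and> right_reach ?L q \<le> share ?X p)"
      unfolding P3_def by (intro ball_cong refl) (simp add: share_eq_mass[OF i])
    moreover have "card (owners N s p) = 1 \<longleftrightarrow> p \<notin> others N s i" if "p \<in> ?X" for p
      using m_pos_iff[of p] card_owners_own[of i N p s] i that by auto
    then have "P4 i \<longleftrightarrow> (\<forall>p\<in>?X - others N s i. (\<exists>a\<in>?L. a < p) \<and> (\<exists>b\<in>?L. p < b))"
      unfolding P4_def by auto
    ultimately show ?thesis
      unfolding stable_def locations_eq_others_Un[OF i, symmetric] by satx
  qed
  then have "pure_nash N n s \<longleftrightarrow> (\<forall>i\<in>{1..N}. P1 i \<and> P2 i \<and> P3 i \<and> P4 i)"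
    unfolding nash_iff_best_response by (intro ball_cong refl)
  moreover have "balanced \<longleftrightarrow> (\<forall>i\<in>{1..N}. P3 i) \<and> (\<forall>i\<in>{1..N}. P4 i)"
  proof -
    have "(\<forall>p\<in>?L. Q p) \<longleftrightarrow> (\<forall>i\<in>{1..N}. \<forall>p\<in>set (s i). Q p)" for Q
      unfolding locations_def by blast
    then show ?thesis
      unfolding balanced_def P3_def P4_def by presburger
  qed
  moreover have "(\<exists>i\<in>{1..N}. \<exists>f\<in>set (s i). \<exists>f'\<in>set (s i). lone N s i f \<and> neighbors N s f f')
      \<longleftrightarrow> \<not> (\<forall>i\<in>{1..N}. P1 i)"
    unfolding P1_def by blast
  ultimately show ?thesis
    unfolding P2_def[symmetric] by blast
qed

end

text \<open>The flattened players at \<open>p\<close> are the images under \<open>M\<close> of the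
  pairs \<open>(i, j)\<close> whose facility is at \<open>p\<close>. As the coordinates of a
  strategy are distinct, such a pair is determined by \<open>i\<close>.\<close>

lemma card_owners_flattened:
  assumes s: "pure_profile N n s"
    and M: "bij_betw M (SIGMA i:{1..N}. {..<n i}) {1..N'}"
    and s': "\<And>i j. i \<in> {1..N} \<Longrightarrow> j < n i \<Longrightarrow> s' (M (i, j)) = [s i ! j]"
  shows "card (owners N' s' p) = card (owners N s p)"
proof -
  let ?S = "SIGMA i:{1..N}. {..<n i}"
  let ?P = "{x \<in> ?S. s (fst x) ! snd x = p}"
  have str: "length (s i) = n i" "distinct (s i)" if "i \<in> {1..N}" for i
    using s that by (auto simp: pure_profile_def strategies_def strict_sorted_iff)
  have "owners N' s' p = M ` ?P"
  proof -
    have "owners N' s' p = {k \<in> M ` ?S. p \<in> set (s' k)}"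
      using M by (simp add: bij_betw_def owners_def)
    also have "\<dots> = M ` {x \<in> ?S. p \<in> set (s' (M x))}"
      by blast
    also have "{x \<in> ?S. p \<in> set (s' (M x))} = ?P"
      using s' by auto
    finally show ?thesis .
  qed
  moreover have "inj_on M ?P"
    using M by (auto simp: bij_betw_def intro: inj_on_subset)
  ultimately have "card (owners N' s' p) = card ?P"
    by (simp add: card_image)
  also have "\<dots> = card (fst ` ?P)"
  proof (rule card_image[symmetric])
    have "x = y" if "x \<in> ?P" "y \<in> ?P" "fst x = fst y" for x y
    proof -
      have "fst x \<in> {1..N}" "snd x < n (fst x)" "snd y < n (fst x)" "s (fst x) ! snd x = s (fst x) ! snd y"
        using that by auto
      then have "snd x = snd y"
        using str[of "fst x"] nth_eq_iff_index_eq[of "s (fst x)" "snd x" "snd y"] by simp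
      then show ?thesis
        using that(3) by (simp add: prod_eq_iff)
    qed
    then show "inj_on fst ?P"
      by (rule inj_onI)
  qed
  also have "fst ` ?P = {i \<in> {1..N}. \<exists>j<n i. s i ! j = p}"
    unfolding fst_eq_Domain by auto
  also have "\<dots> = owners N s p"
    unfolding owners_def in_set_conv_nth using str(1) by (intro Collect_cong conj_cong refl) simp
  finally show ?thesis .
qed

lemma locations_eq_owners: "locations N s = {p. owners N s p \<noteq> {}}"
  by (auto simp: locations_def owners_def)

theorem theorem4:
  fixes N :: nat and n :: "nat \<Rightarrow> nat" and s s' :: "nat \<Rightarrow> real list"
  assumes "multi_unit_game N n" and "N \<ge> 3"
    and "pure_profile N n s"
    and "flattened_profile N n s s'"
  shows "pure_nash N n s \<longleftrightarrow>
      \<not> (\<exists>i\<in>{1..N}. \<exists>f\<in>set (s i). \<exists>f'\<in>set (s i). lone N s i f \<and> neighbors N s f f')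
    \<and> (\<forall>i\<in>{1..N}. \<forall>f\<in>set (s i). \<forall>f'\<in>set (s i). facility_mass N s f = facility_mass N s f')
    \<and> pure_nash (flat_players N n) flat_sizes s'"
proof -
  let ?N' = "flat_players N n"
  have pos: "0 < n i" if "i \<in> {1..N}" for i
    using assms(1) that by (simp add: multi_unit_game_def)
  \<comment> \<open>Every player brings at least one facility, so flattening does not reduce the
    number of players.\<close>
  have "(\<Sum>i=1..N. 1) \<le> ?N'"
    unfolding flat_players_def using pos by (intro sum_mono) (simp add: Suc_le_eq)
  then have N': "2 \<le> ?N'"
    using assms(2) by simp
  obtain M where M: "bij_betw M (SIGMA i:{1..N}. {..<n i}) {1..?N'}"
    "\<And>i j. i \<in> {1..N} \<Longrightarrow> j < n i \<Longrightarrow> s' (M (i, j)) = [s i ! j]"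
    and profile': "pure_profile ?N' flat_sizes s'"
    using assms(4) unfolding flattened_profile_def by blast
  interpret orig: profile N n s
    using assms(2,3) pos by unfold_locales auto
  interpret flat: profile ?N' flat_sizes s'
    using N' profile' by unfold_locales auto
  have own: "card (owners ?N' s' p) = card (owners N s p)" for p
    by (rule card_owners_flattened[OF assms(3) M])
  \<comment> \<open>Owner sets are finite, so equal numbers of owners yield equal sets of
    locations.\<close>
  have "finite (owners N'' t p)" for N'' t p
    by (simp add: owners_def)
  then have "owners ?N' s' p = {} \<longleftrightarrow> owners N s p = {}" for p
    using own[of p] card_0_eq by metis
  then have loc: "locations ?N' s' = locations N s"
    by (simp add: locations_eq_owners)
  have mass: "facility_mass ?N' s' p = facility_mass N s p" if "p \<in> locations N s" for p
    using orig.mass_eq[OF that] flat.mass_eq[of p] that by (simp add: loc own)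
  have "flat.balanced \<longleftrightarrow> orig.balanced"
    unfolding flat.balanced_def orig.balanced_def by (simp add: loc own mass)
  \<comment> \<open>A flattened player has a single facility, and a point is not its own neighbor,
    so the first two conditions hold trivially in the flattened game.\<close>
  moreover have "f = f'" if "k \<in> {1..?N'}" "f \<in> set (s' k)" "f' \<in> set (s' k)" for k f f'
    using flat.strategy[OF that(1)] that by (auto simp: strategies_def length_Suc_conv)
  then have "\<forall>k\<in>{1..?N'}. \<forall>f\<in>set (s' k). \<forall>f'\<in>set (s' k). facility_mass ?N' s' f = facility_mass ?N' s' f'"
    and "\<not> (\<exists>k\<in>{1..?N'}. \<exists>f\<in>set (s' k). \<exists>f'\<in>set (s' k). lone ?N' s' k f \<and> neighbors ?N' s' f f')"
    by (metis, metis neighbors_def)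
  ultimately have "pure_nash ?N' flat_sizes s' \<longleftrightarrow> orig.balanced"
    using flat.nash_iff_balanced by satx
  then show ?thesis
    using orig.nash_iff_balanced by satx
qed

end
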